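(* Suppose $\pi_k^+\ge\pi_k^-$ for all $k\in\mathcal K$, and that the uniqueness and non-accumulation assumptions stated in the context hold. Let $(\mathbf u^*_\rho,\boldsymbol\xi^*_\rho,\mathbf x^*_\rho)$ be the solution of $$\min_{\mathbf u,\boldsymbol\xi,\mathbf x}\ J(\mathbf r)+\rho\sum_{i\in\mathcal N}\xi_i\quad\text{s.t.}\quad \mathbf x_k\in\tilde{\mathcal X}_k\big(b_0,u_k-\xi_i,\xi_i+\beta_k^{(i)}\big),\ \ u_k\ge\ell_k^{(i)},\quad\forall k\in\mathcal K,\ \forall i\in\mathcal N,$$ with $\boldsymbol\xi=(\xi_i)_{i\in\mathcal N}\in\mathbb R^N_{\ge0}$ and $\rho\in\mathbb R_{\ge0}$, and let $(\mathbf r^*_\rho,\mathbf b^*_\rho)$ be the components of $\mathbf x^*_\rho$. Let $\delta\in(0,1)$. For $m=0,\dots,N-1$ consider the polynomial equation in $t$ $$\binom{N}{m}t^{N-m}-\frac{\delta}{2N}\sum_{i=m}^{N-1}\binom{i}{m}t^{i-m}-\frac{\delta}{6N}\sum_{i=N+1}^{4N}\binom{i}{m}t^{i-m}=0,$$ and for $m=N$ consider the equation $$1-\frac{\delta}{6N}\sum_{i=N+1}^{4N}\binom{i}{N}t^{i-N}=0.$$ For each $m=0,\dots,N-1$ the first equation has exactly two solutions in $[0,+\infty)$, denoted $t^{(m)}\le\bar t^{(m)}$; the second equation has exactly one solution in $[0,+\infty)$, denoted $\bar t^{(N)}$, and one sets $t^{(N)}:=0$. Let $\underline\epsilon(m):=\max\{0,1-\bar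 t^{(m)}\}$ and $\overline\epsilon(m):=1-t^{(m)}$ for $m=0,\dots,N$. Then, with confidence at least $1-\delta$ (i.e., with $\mathbb P^N$-probability at least $1-\delta$), $$\underline\epsilon(\tilde s_N^* )\ \le\ \mathbb V(\mathbf r^*_\rho,\mathbf b^*_\rho)\ \le\ \overline\epsilon(\tilde s_N^* ),$$ where $\tilde s_N^*$ is the number of samples $(\boldsymbol\ell^{(i)},\boldsymbol\beta^{(i)})$, $i\in\mathcal N$, for which there exists $k\in\mathcal K$ such that $b_k^*\le b_{k-1}^*+q_k+r_k^*-\ell_k^{(i)}$ or $b_k^*\ge\beta_k^{(i)}$, with $r_k^*,b_k^*$ the components of $\mathbf r^*_\rho,\mathbf b^*_\rho$ (and $b_0^*=b_0$).
   Context: Let $K\in\mathbb N$, $\mathcal K=\{1,\dots,K\}$, $N\in\mathbb N$, $\mathcal N=\{1,\dots,N\}$. Fixed data: $b_0\in\mathbb R$ (initial state), $q_k\in\mathbb R$ (prosumer energy request), $r_{\max}\geq 0$, and prices $\pi_k^+,\pi_k^-\in\mathbb R_{\ge0}$, $k\in\mathcal K$. The variables are $\mathbf r=(r_k)_{k\in\mathcal K}\in\mathbb R^K$, $\mathbf b=(b_k)_{k\in\mathcal K}\in\mathbb R^K$, $\mathbf x_k=(r_k,b_k)$, $\mathbf x=(\mathbf x_k)_{k\in\mathcal K}$, $\mathbf u=(u_k)_{k\in\mathcal K}\in\mathbb R_{\ge0}^K$, and $\boldsymbol\xi\in\mathbb R^N_{\ge0}$. Objective: $J(\mathbf r)=\sum_{k\in\mathcal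 K}\big(\pi_k^+[r_k]_++\pi_k^-[r_k]_-\big)$ with $[a]_+=\max\{0,a\}$ and $[a]_-=-\min\{0,a\}$. Constraint sets: for $\ell_k,\beta_k\in\mathbb R$, $$\tilde{\mathcal X}_k(b_0,\ell_k,\beta_k)=\{(r_k,b_k)\in\mathbb R^2:\ b_k\ge b_{k-1}+q_k+r_k-\ell_k,\ b_k\in[0,\beta_k],\ |r_k|\le r_{\max}\},$$ where $b_{k-1}$ is the preceding component of $\mathbf b$ (and equals the given $b_0$ when $k=1$). Uncertainty: $(\boldsymbol\ell,\boldsymbol\beta)$, with $\boldsymbol\ell=(\ell_k)_{k\in\mathcal K}$, $\boldsymbol\beta=(\beta_k)_{k\in\mathcal K}$, takes values in $(\mathcal L\times\mathcal B)^K$ with $\mathcal L,\mathcal B\subset\mathbb R_{\ge0}$, and follows an unknown probability distribution $\mathbb P$. The samples $(\boldsymbol\ell^{(i)},\boldsymbol\beta^{(i)})$, $i\in\mathcal N$, are i.i.d. from $\mathbb P$; $\mathbb P^N$ is the product measure. Probability of violation: $$\mathbb V(\mathbf r,\mathbf b)=\mathbb P\{(\tilde{\boldsymbol\ell},\tilde{\boldsymbol\beta}):\ \exists k\in\mathcal K\text{ such that }\mathbf x_k\notin\tilde{\mathcal X}_k(b_0,\tilde\ell_k,\tilde\beta_k)\}.$$ Uniqueness assumption: for any $N\in\mathbb N$ and every choice of samples, the solution of the optimization program is unique (e.g., singled out by a convex tie-break rule). Non-accumulation assumption: for every decision $(\mathbf r,\mathbf b,\mathbf u)$, $\mathbb P\{\exists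 k\in\mathcal K:\ b_k=b_{k-1}+q_k+r_k-\ell_k\ \text{or}\ b_k=\beta_k\}=0$.
   Formalization: As u is free of cost and unbounded, the solution is never literally unique; here it is a minimizer that also minimizes a convex tie-break in (r,b) alone, and only its (r,b) part is assumed unique; a tie-break coupling u with (r,b) can make the claim false. *)

theory Defs
  imports "HOL-Probability.Probability"
begin

(* The time horizon {1..K} is a finite linearly ordered index type 'k with CARD('k) = K;
   the order is needed only to speak of the preceding component. A sample is a pair
   (l, beta) of vectors in R^K, a decision x is the pair (r, b). *)

type_synonym 'k rvec = "(real, 'k) vec"
type_synonym 'k rvec_pair = "'k rvec \<times> 'k rvec"

definition pos_part :: "real \<Rightarrow> real" where
  "pos_part a = max 0 a"

definition neg_part :: "real \<Rightarrow> real" where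
  "neg_part a = - min 0 a"

definition cost :: "('k::finite) rvec \<Rightarrow> 'k rvec \<Rightarrow> 'k rvec \<Rightarrow> real" where
  "cost \<pi>p \<pi>m r = (\<Sum>k\<in>UNIV. \<pi>p $ k * pos_part (r $ k) + \<pi>m $ k * neg_part (r $ k))"

definition prev_state :: "real \<Rightarrow> ('k::{finite,linorder}) rvec \<Rightarrow> 'k \<Rightarrow> real" where
  "prev_state b0 b k = (if {..<k} = {} then b0 else b $ Max {..<k})"

definition stage_set :: "real \<Rightarrow> real \<Rightarrow> real \<Rightarrow> real \<Rightarrow> real \<Rightarrow> (real \<times> real) set" where
  "stage_set rmax bprev qk l \<beta> =
     {(r, b). b \<ge> bprev + qk + r - l \<and> b \<in> {0..\<beta>} \<and> \<bar>r\<bar> \<le> rmax}"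

definition uncertainty_set :: "real set \<Rightarrow> real set \<Rightarrow> ('k::finite) rvec_pair set" where
  "uncertainty_set L B = {(l, \<beta>). \<forall>k. l $ k \<in> L \<and> \<beta> $ k \<in> B}"

definition feasible ::
  "real \<Rightarrow> ('k::{finite,linorder}) rvec \<Rightarrow> real \<Rightarrow> nat \<Rightarrow> (nat \<Rightarrow> 'k rvec_pair)
   \<Rightarrow> ('k rvec \<times> (nat \<Rightarrow> real) \<times> 'k rvec_pair) set" where
  "feasible b0 q rmax N \<omega> =
     {(u, \<xi>, r, b). (\<forall>k. 0 \<le> u $ k) \<and> \<xi> \<in> {1..N} \<rightarrow>\<^sub>E {0..} \<and>
        (\<forall>k. \<forall>i\<in>{1..N}.
           (r $ k, b $ k) \<in> stage_set rmax (prev_state b0 b k) (q $ k)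
                              (u $ k - \<xi> i) (\<xi> i + snd (\<omega> i) $ k) \<and>
           u $ k \<ge> fst (\<omega> i) $ k)}"

definition objective ::
  "('k::finite) rvec \<Rightarrow> 'k rvec \<Rightarrow> real \<Rightarrow> nat
   \<Rightarrow> 'k rvec \<times> (nat \<Rightarrow> real) \<times> 'k rvec_pair \<Rightarrow> real" where
  "objective \<pi>p \<pi>m \<rho> N = (\<lambda>(u, \<xi>, r, b). cost \<pi>p \<pi>m r + \<rho> * (\<Sum>i\<in>{1..N}. \<xi> i))"

definition minimizer ::
  "real \<Rightarrow> ('k::{finite,linorder}) rvec \<Rightarrow> real \<Rightarrow> 'k rvec \<Rightarrow> 'k rvec \<Rightarrow> real \<Rightarrow> nat \<Rightarrow> (nat \<Rightarrow> 'k rvec_pair)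
   \<Rightarrow> 'k rvec \<times> (nat \<Rightarrow> real) \<times> 'k rvec_pair \<Rightarrow> bool" where
  "minimizer b0 q rmax \<pi>p \<pi>m \<rho> N \<omega> z \<longleftrightarrow>
     is_arg_min (objective \<pi>p \<pi>m \<rho> N) (\<lambda>z. z \<in> feasible b0 q rmax N \<omega>) z"

(* A solution is a minimizer that is best for the tie-break function tb among all
   minimizers; for constant tb it is just a minimizer. A tie-break is indispensable for
   uniqueness: u is not bounded above and does not enter the objective, so it can be
   increased at any minimizer. The tie-break ranks the decisions x = (r, b) only; u and
   the slacks need not be unique and do not occur in the violation probability. *)
definition solution ::
  "(('k::{finite,linorder}) rvec_pair \<Rightarrow> real)
   \<Rightarrow> real \<Rightarrow> 'k rvec \<Rightarrow> real \<Rightarrow> 'k rvec \<Rightarrow> 'k rvec \<Rightarrow> real \<Rightarrow> nat \<Rightarrow> (nat \<Rightarrow> 'k rvec_pair)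
   \<Rightarrow> 'k rvec \<times> (nat \<Rightarrow> real) \<times> 'k rvec_pair \<Rightarrow> bool" where
  "solution tb b0 q rmax \<pi>p \<pi>m \<rho> N \<omega> z \<longleftrightarrow>
     is_arg_min (\<lambda>(u, \<xi>, x). tb x) (minimizer b0 q rmax \<pi>p \<pi>m \<rho> N \<omega>) z"

definition violation ::
  "('k::{finite,linorder}) rvec_pair measure \<Rightarrow> real \<Rightarrow> 'k rvec \<Rightarrow> real
   \<Rightarrow> 'k rvec \<Rightarrow> 'k rvec \<Rightarrow> real" where
  "violation P b0 q rmax r b =
     measure P {s \<in> space P. \<exists>k. (r $ k, b $ k) \<notin>
       stage_set rmax (prev_state b0 b k) (q $ k) (fst s $ k) (snd s $ k)}"

definition num_critical ::
  "real \<Rightarrow> ('k::{finite,linorder}) rvec \<Rightarrow> nat \<Rightarrow> (nat \<Rightarrow> 'k rvec_pair)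
   \<Rightarrow> 'k rvec \<Rightarrow> 'k rvec \<Rightarrow> nat" where
  "num_critical b0 q N \<omega> r b =
     card {i \<in> {1..N}. \<exists>k.
       b $ k \<le> prev_state b0 b k + q $ k + r $ k - fst (\<omega> i) $ k \<or> b $ k \<ge> snd (\<omega> i) $ k}"

definition eps_equation :: "nat \<Rightarrow> real \<Rightarrow> nat \<Rightarrow> real \<Rightarrow> bool" where
  "eps_equation N \<delta> m t \<longleftrightarrow>
     (if m < N then
        real (N choose m) * t ^ (N - m)
        - \<delta> / (2 * real N) * (\<Sum>i=m..N-1. real (i choose m) * t ^ (i - m))
        - \<delta> / (6 * real N) * (\<Sum>i=N+1..4*N. real (i choose m) * t ^ (i - m)) = 0
      else
        1 - \<delta> / (6 * real N) * (\<Sum>i=N+1..4*N. real (i choose N) * t ^ (i - N)) = 0)"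

definition eps_roots :: "nat \<Rightarrow> real \<Rightarrow> nat \<Rightarrow> real set" where
  "eps_roots N \<delta> m = {t. 0 \<le> t \<and> eps_equation N \<delta> m t}"

(* Min and Max presuppose a nonempty finite set of roots: two roots for m < N,
   a single one for m = N. *)
definition t_lower :: "nat \<Rightarrow> real \<Rightarrow> nat \<Rightarrow> real" where
  "t_lower N \<delta> m = (if m < N then Min (eps_roots N \<delta> m) else 0)"

definition t_upper :: "nat \<Rightarrow> real \<Rightarrow> nat \<Rightarrow> real" where
  "t_upper N \<delta> m = Max (eps_roots N \<delta> m)"

definition eps_lower :: "nat \<Rightarrow> real \<Rightarrow> nat \<Rightarrow> real" where
  "eps_lower N \<delta> m = max 0 (1 - t_upper N \<delta> m)"

definition eps_upper :: "nat \<Rightarrow> real \<Rightarrow> nat \<Rightarrow> real" where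
  "eps_upper N \<delta> m = 1 - t_lower N \<delta> m"

end

theory Submission
  imports Defs
begin

text \<open>
  Since \<open>u\<close> is free of charge and unbounded above, the constraints containing it are vacuous, and
  the optimal value is 0. Hence the solution \<open>x = (r, b)\<close> minimises the tie-break over a convex set
  of candidates, and adding samples that are not critical for a solution, or removing them, does
  not change it. Consequently, the critical samples out of \<open>M\<close> form the set \<open>S\<close> if and only if all
  samples in \<open>S\<close> are critical for the solution computed from \<open>S\<close> alone and the others are not.
  With \<open>t\<close> denoting one minus the violation probability of that solution, the event has probability
  \<open>\<integral> t ^ (M - card S) d\<mu>\<close>, where the measure \<open>\<mu>\<close> depends only on \<open>m = card S\<close>. Summing over
  \<open>S\<close> gives \<open>(\<Sum>m\<le>M. (M choose m) * \<integral> t ^ (M - m) d\<mu>\<^sub>m) \<le> 1\<close> for each \<open>M\<close>. The polynomial equations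
  weigh these inequalities by \<open>\<delta> / (2 N)\<close> for \<open>M < N\<close> and by \<open>\<delta> / (6 N)\<close> for \<open>N < M \<le> 4 N\<close>, in
  total \<open>\<delta>\<close>, and outside the interval between the two roots the weighted sum dominates the
  integrand for \<open>M = N\<close>.
\<close>

subsection \<open>Decisions determined by their critical samples\<close>

text \<open>The decision depends on the set of samples, not on the sequence: this builds in
  invariance under reordering and repetition. \<open>dec_extend\<close> and \<open>dec_prune\<close>
  are two directions of one principle. The first passes from the smaller sample set to the larger
  one and judges criticality by the decision of the smaller; the second goes back and judges by the
  decision of the larger.\<close>

locale scenario_rule = prob_space P for P :: "'s measure" +
  fixes D :: "'d measure" and dec :: "'s set \<Rightarrow> 'd" and crit :: "'d \<Rightarrow> 's \<Rightarrow> bool"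
    and ok :: bool
  assumes crit_measurable [measurable]: "Measurable.pred (D \<Otimes>\<^sub>M P) (\<lambda>(x, s). crit x s)"
    and dec_measurable:
      "finite I \<Longrightarrow> (\<lambda>\<omega> :: nat \<Rightarrow> 's. dec (\<omega> ` I)) \<in> Pi\<^sub>M I (\<lambda>_. P) \<rightarrow>\<^sub>M D"
    and dec_extend: "\<lbrakk>finite A'; A \<subseteq> A'; A' \<subseteq> space P; A' \<noteq> {}; A \<noteq> {} \<or> ok;
      \<And>s. s \<in> A' - A \<Longrightarrow> \<not> crit (dec A) s\<rbrakk> \<Longrightarrow> dec A' = dec A"
    and dec_prune: "\<lbrakk>finite A'; A \<subseteq> A'; A' \<subseteq> space P; A' \<noteq> {};
      \<And>s. s \<in> A' - A \<Longrightarrow> \<not> crit (dec A') s\<rbrakk> \<Longrightarrow> (A \<noteq> {} \<or> ok) \<and> dec A = dec A'"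
begin

text \<open>\<open>ok\<close> states whether \<open>dec {}\<close> is meaningful: without samples there may be no unique decision.\<close>

sublocale product: product_sigma_finite "\<lambda>_::nat. P"
  by standard

definition safe :: "'d \<Rightarrow> real" where
  "safe x = prob {s \<in> space P. \<not> crit x s}"

definition self_critical :: "nat set \<Rightarrow> (nat \<Rightarrow> 's) \<Rightarrow> bool" where
  "self_critical S \<omega> \<longleftrightarrow> (S \<noteq> {} \<or> ok) \<and> (\<forall>i\<in>S. crit (dec (\<omega> ` S)) (\<omega> i))"

definition critical_event :: "nat set \<Rightarrow> nat set \<Rightarrow> (nat \<Rightarrow> 's) set" where
  "critical_event M S = {\<omega> \<in> space (Pi\<^sub>M M (\<lambda>_. P)).
     self_critical S \<omega> \<and> (\<forall>i\<in>M - S. \<not> crit (dec (\<omega> ` S)) (\<omega> i))}"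

text \<open>The integral of \<open>h\<close> against the unnormalised measure \<mu> of the
  introduction: the law of \<open>safe\<close> at the decision computed from the samples in
  \<open>S\<close>, restricted to the event that all of them are critical for it.\<close>

definition moment :: "nat set \<Rightarrow> (real \<Rightarrow> ennreal) \<Rightarrow> ennreal" where
  "moment S h = (\<integral>\<^sup>+\<omega>. indicator {\<omega>. self_critical S \<omega>} \<omega> * h (safe (dec (\<omega> ` S)))
     \<partial>Pi\<^sub>M S (\<lambda>_. P))"

lemma safe_bounds: "0 \<le> safe x" "safe x \<le> 1"
  by (auto simp: safe_def)

lemma safe_measurable [measurable]: "safe \<in> borel_measurable D"
  unfolding safe_def by measurable

lemma crit_pred [measurable (raw)]:
  assumes [measurable]: "f \<in> M \<rightarrow>\<^sub>M D" "g \<in> M \<rightarrow>\<^sub>M P"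
  shows "Measurable.pred M (\<lambda>x. crit (f x) (g x))"
proof -
  have "(\<lambda>x. (f x, g x)) \<in> M \<rightarrow>\<^sub>M D \<Otimes>\<^sub>M P"
    by measurable
  from measurable_compose[OF this crit_measurable] show ?thesis
    by simp
qed

lemma crit_slice: "x \<in> space D \<Longrightarrow> Measurable.pred P (crit x)"
  by (rule crit_pred[where f = "\<lambda>_. x" and g = "\<lambda>s. s"]) (auto intro: measurable_const)

lemma dec_measurable_subset:
  fixes M :: "nat set"
  assumes "finite M" "S \<subseteq> M"
  shows "(\<lambda>\<omega>. dec (\<omega> ` S)) \<in> Pi\<^sub>M M (\<lambda>_. P) \<rightarrow>\<^sub>M D"
proof -
  have "finite S"
    using assms finite_subset by blast
  have "(\<lambda>\<omega>. dec (restrict \<omega> S ` S)) \<in> Pi\<^sub>M M (\<lambda>_. P) \<rightarrow>\<^sub>M D"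
    by (rule measurable_compose[OF measurable_restrict_subset[OF assms(2)] dec_measurable[OF \<open>finite S\<close>]])
  then show ?thesis
    by simp
qed

lemma self_critical_measurable:
  assumes "finite M" "S \<subseteq> M"
  shows "Measurable.pred (Pi\<^sub>M M (\<lambda>_. P)) (self_critical S)"
proof -
  note dec_measurable_subset[OF assms, measurable]
  have [measurable]: "finite S"
    using assms finite_subset by blast
  have [measurable]: "Measurable.pred (Pi\<^sub>M M (\<lambda>_. P)) (\<lambda>\<omega>. crit (dec (\<omega> ` S)) (\<omega> i))" if "i \<in> S" for i
  proof (rule crit_pred)
    show "(\<lambda>\<omega>. \<omega> i) \<in> Pi\<^sub>M M (\<lambda>_. P) \<rightarrow>\<^sub>M P"
      using that assms by (intro measurable_component_singleton) auto
  qed measurable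
  show ?thesis
    unfolding self_critical_def by measurable
qed

lemma critical_event_sets:
  assumes "finite M" "S \<subseteq> M" and [measurable]: "Q \<in> sets borel"
  shows "{\<omega> \<in> critical_event M S. safe (dec (\<omega> ` S)) \<in> Q} \<in> sets (Pi\<^sub>M M (\<lambda>_. P))"
proof -
  note dec_measurable_subset[OF assms(1,2), measurable] self_critical_measurable[OF assms(1,2), measurable]
  have [measurable]: "finite (M - S)"
    using assms by auto
  have [measurable]: "Measurable.pred (Pi\<^sub>M M (\<lambda>_. P)) (\<lambda>\<omega>. crit (dec (\<omega> ` S)) (\<omega> i))" if "i \<in> M - S" for i
  proof (rule crit_pred)
    show "(\<lambda>\<omega>. \<omega> i) \<in> Pi\<^sub>M M (\<lambda>_. P) \<rightarrow>\<^sub>M P"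
      using that assms by (intro measurable_component_singleton) auto
  qed measurable
  have "{\<omega> \<in> space (Pi\<^sub>M M (\<lambda>_. P)). (self_critical S \<omega> \<and> (\<forall>i\<in>M - S. \<not> crit (dec (\<omega> ` S)) (\<omega> i)))
      \<and> safe (dec (\<omega> ` S)) \<in> Q} \<in> sets (Pi\<^sub>M M (\<lambda>_. P))"
    by measurable
  also have "{\<omega> \<in> space (Pi\<^sub>M M (\<lambda>_. P)). (self_critical S \<omega> \<and> (\<forall>i\<in>M - S. \<not> crit (dec (\<omega> ` S)) (\<omega> i)))
      \<and> safe (dec (\<omega> ` S)) \<in> Q} = {\<omega> \<in> critical_event M S. safe (dec (\<omega> ` S)) \<in> Q}"
    by (auto simp: critical_event_def)
  finally show ?thesis .
qed

text \<open>With the decision held fixed the event is a box, so independence turns its probability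
  into a power.\<close>

lemma emeasure_noncritical:
  fixes T :: "nat set"
  assumes "finite T" "x \<in> space D"
  shows "emeasure (Pi\<^sub>M T (\<lambda>_. P)) {\<tau> \<in> space (Pi\<^sub>M T (\<lambda>_. P)). \<forall>i\<in>T. \<not> crit x (\<tau> i)}
    = ennreal (safe x ^ card T)"
proof -
  have nc: "{s \<in> space P. \<not> crit x s} \<in> sets P"
    by (rule predE[OF pred_intros_logic(2)[OF crit_slice[OF assms(2)]]])
  have "{\<tau> \<in> space (Pi\<^sub>M T (\<lambda>_. P)). \<forall>i\<in>T. \<not> crit x (\<tau> i)} = (\<Pi>\<^sub>E i\<in>T. {s \<in> space P. \<not> crit x s})"
    by (auto simp: space_PiM PiE_iff extensional_def)
  then show ?thesis
    using assms nc by (simp add: product.emeasure_PiM emeasure_eq_measure safe_def ennreal_power)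
qed

text \<open>Fubini: once the samples in \<open>S\<close> are fixed, so is the decision, and the
  remaining \<open>card M - card S\<close> samples are independent of it. The set \<open>Q\<close>
  is kept general because both the whole event (\<open>Q = UNIV\<close>) and its intersection with
  an unwanted range of \<open>safe\<close> are measured later.\<close>

lemma emeasure_critical_event:
  assumes M: "finite M" "S \<subseteq> M" and Q[measurable]: "Q \<in> sets borel"
  shows "emeasure (Pi\<^sub>M M (\<lambda>_. P)) {\<omega> \<in> critical_event M S. safe (dec (\<omega> ` S)) \<in> Q}
    = moment S (\<lambda>t. indicator Q t * ennreal (t ^ (card M - card S)))"
proof -
  define T where "T = M - S"
  have T: "S \<inter> T = {}" "finite S" "finite T" "M = S \<union> T" "card T = card M - card S"
    using M finite_subset[OF M(2)] by (auto simp: T_def card_Diff_subset)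
  define E where "E = {\<omega> \<in> critical_event M S. safe (dec (\<omega> ` S)) \<in> Q}"
  have E: "E \<in> sets (Pi\<^sub>M (S \<union> T) (\<lambda>_. P))"
    unfolding E_def T(4)[symmetric] by (rule critical_event_sets[OF M Q])
  have "emeasure (Pi\<^sub>M M (\<lambda>_. P)) E = (\<integral>\<^sup>+\<omega>. indicator E \<omega> \<partial>Pi\<^sub>M (S \<union> T) (\<lambda>_. P))"
    using E T(4) by simp
  also have "\<dots> = (\<integral>\<^sup>+\<omega>. \<integral>\<^sup>+\<tau>. indicator E (merge S T (\<omega>, \<tau>)) \<partial>Pi\<^sub>M T (\<lambda>_. P) \<partial>Pi\<^sub>M S (\<lambda>_. P))"
    using E by (intro product.product_nn_integral_fold T) auto
  also have "\<dots> = moment S (\<lambda>t. indicator Q t * ennreal (t ^ (card M - card S)))"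
    unfolding moment_def
  proof (rule nn_integral_cong)
    fix \<omega> assume \<omega>: "\<omega> \<in> space (Pi\<^sub>M S (\<lambda>_. P))"
    let ?F = "{\<tau> \<in> space (Pi\<^sub>M T (\<lambda>_. P)). \<forall>i\<in>T. \<not> crit (dec (\<omega> ` S)) (\<tau> i)}"
    have x: "dec (\<omega> ` S) \<in> space D"
      using dec_measurable[OF T(2)] \<omega> by (auto dest: measurable_space)
    have im: "merge S T (\<omega>, \<tau>) ` S = \<omega> ` S" for \<tau>
      by (auto simp: merge_def image_def)
    have "indicator E (merge S T (\<omega>, \<tau>)) =
      indicator {\<omega>. self_critical S \<omega>} \<omega> * indicator Q (safe (dec (\<omega> ` S))) * (indicator ?F \<tau> :: ennreal)"
      if \<tau>: "\<tau> \<in> space (Pi\<^sub>M T (\<lambda>_. P))" for \<tau>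
    proof -
      have "merge S T (\<omega>, \<tau>) \<in> space (Pi\<^sub>M M (\<lambda>_. P))"
        using \<omega> \<tau> T by (auto simp: space_PiM merge_def PiE_iff extensional_def)
      moreover have "self_critical S (merge S T (\<omega>, \<tau>)) = self_critical S \<omega>"
        unfolding self_critical_def im by (auto simp: merge_def)
      moreover have "(\<forall>i\<in>M - S. \<not> crit (dec (merge S T (\<omega>, \<tau>) ` S)) (merge S T (\<omega>, \<tau>) i))
          = (\<forall>i\<in>T. \<not> crit (dec (\<omega> ` S)) (\<tau> i))"
        unfolding im T_def[symmetric] using T(1) by (auto simp: merge_def)
      ultimately show ?thesis
        using \<tau> by (auto simp: E_def critical_event_def im indicator_def)
    qed
    then have "(\<integral>\<^sup>+\<tau>. indicator E (merge S T (\<omega>, \<tau>)) \<partial>Pi\<^sub>M T (\<lambda>_. P))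
      = (\<integral>\<^sup>+\<tau>. indicator {\<omega>. self_critical S \<omega>} \<omega> * indicator Q (safe (dec (\<omega> ` S)))
          * (indicator ?F \<tau> :: ennreal) \<partial>Pi\<^sub>M T (\<lambda>_. P))"
      by (intro nn_integral_cong) auto
    also have "\<dots> = indicator {\<omega>. self_critical S \<omega>} \<omega> * indicator Q (safe (dec (\<omega> ` S)))
        * emeasure (Pi\<^sub>M T (\<lambda>_. P)) ?F"
    proof -
      have "?F \<in> sets (Pi\<^sub>M T (\<lambda>_. P))"
      proof -
        have [measurable]: "Measurable.pred P (crit (dec (\<omega> ` S)))"
          by (rule crit_slice[OF x])
        show ?thesis
          using T(3) by measurable
      qed
      then show ?thesis
        by (simp add: nn_integral_cmult)
    qed
    finally show "(\<integral>\<^sup>+\<tau>. indicator E (merge S T (\<omega>, \<tau>)) \<partial>Pi\<^sub>M T (\<lambda>_. P)) =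
      indicator {\<omega>. self_critical S \<omega>} \<omega> *
        (indicator Q (safe (dec (\<omega> ` S))) * ennreal (safe (dec (\<omega> ` S)) ^ (card M - card S)))"
      using emeasure_noncritical[OF T(3) x] T(5) by (simp add: mult.assoc)
  qed
  finally show ?thesis
    by (simp add: E_def)
qed

lemma moment_measurable:
  fixes h :: "real \<Rightarrow> ennreal"
  assumes "finite S" and [measurable]: "h \<in> borel_measurable borel"
  shows "(\<lambda>\<omega>. indicator {\<omega>. self_critical S \<omega>} \<omega> * h (safe (dec (\<omega> ` S))))
    \<in> borel_measurable (Pi\<^sub>M S (\<lambda>_. P))"
proof -
  have "(\<lambda>\<omega>. h (safe (dec (\<omega> ` S)))) \<in> borel_measurable (Pi\<^sub>M S (\<lambda>_. P))"
    by (intro measurable_compose[OF dec_measurable[OF assms(1)]] measurable_compose[OF safe_measurable] assms)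
  moreover have "{\<omega> \<in> space (Pi\<^sub>M S (\<lambda>_. P)). self_critical S \<omega>} \<in> sets (Pi\<^sub>M S (\<lambda>_. P))"
    by (rule predE[OF self_critical_measurable[OF assms(1) subset_refl]])
  ultimately have *: "(\<lambda>\<omega>. indicator {\<omega> \<in> space (Pi\<^sub>M S (\<lambda>_. P)). self_critical S \<omega>} \<omega>
      * h (safe (dec (\<omega> ` S)))) \<in> borel_measurable (Pi\<^sub>M S (\<lambda>_. P))"
    by (intro borel_measurable_times_ennreal borel_measurable_indicator)
  show ?thesis
    by (rule measurable_cong[THEN iffD1, OF _ *]) (simp add: indicator_def)
qed

text \<open>The samples are identically distributed and \<open>dec\<close> sees only their set, so
  renaming the indices along a bijection changes nothing.\<close>

lemma moment_cong_card:
  assumes "finite S" "finite T" "card S = card T" and h: "h \<in> borel_measurable borel"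
  shows "moment S h = moment T h"
proof -
  obtain f where f: "bij_betw f S T"
    using assms finite_same_card_bij by blast
  have fS: "f ` S = T"
    using f by (rule bij_betw_imp_surj_on)
  let ?g = "\<lambda>\<omega>. \<lambda>n\<in>S. \<omega> (f n)"
  have im: "?g \<omega> ` S = \<omega> ` T" for \<omega>
    using fS by (auto simp: image_def)
  have g: "?g \<in> Pi\<^sub>M T (\<lambda>_. P) \<rightarrow>\<^sub>M Pi\<^sub>M S (\<lambda>_. P)"
    using fS by (intro measurable_restrict measurable_component_singleton) auto
  have "moment S h = (\<integral>\<^sup>+\<omega>. indicator {\<omega>. self_critical S \<omega>} \<omega> * h (safe (dec (\<omega> ` S)))
      \<partial>distr (Pi\<^sub>M T (\<lambda>_. P)) (Pi\<^sub>M S (\<lambda>_. P)) ?g)"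
    unfolding moment_def using f fS
    by (subst distr_PiM_reindex[where K = T and M = "\<lambda>_. P"])
      (auto simp: bij_betw_def prob_space_axioms)
  also have "\<dots> = (\<integral>\<^sup>+\<omega>. indicator {\<omega>. self_critical S \<omega>} (?g \<omega>) * h (safe (dec (?g \<omega> ` S)))
      \<partial>Pi\<^sub>M T (\<lambda>_. P))"
    by (rule nn_integral_distr[OF g, unfolded measurable_distr_eq1, OF moment_measurable[OF assms(1) h]])
  also have "\<dots> = moment T h"
    unfolding moment_def
  proof (rule nn_integral_cong)
    fix \<omega>
    have "self_critical S (?g \<omega>) = self_critical T \<omega>"
      unfolding self_critical_def im using fS by auto
    then show "indicator {\<omega>. self_critical S \<omega>} (?g \<omega>) * h (safe (dec (?g \<omega> ` S)))
      = indicator {\<omega>. self_critical T \<omega>} \<omega> * h (safe (dec (\<omega> ` T)))"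
      unfolding im by (simp add: indicator_def)
  qed
  finally show ?thesis .
qed


section \<open>Decomposition of the sample space by the set of critical samples\<close>

definition critical_set :: "nat set \<Rightarrow> (nat \<Rightarrow> 's) \<Rightarrow> nat set" where
  "critical_set M \<omega> = {i \<in> M. crit (dec (\<omega> ` M)) (\<omega> i)}"

text \<open>By \<open>dec_extend\<close>, adding the samples outside \<open>S\<close>, none of which
  is critical, keeps the decision. Hence criticality for the decision from \<open>S\<close> is
  criticality for the full decision, and \<open>S\<close> can be read off from \<omega>; in
  particular events for distinct \<open>S\<close> are disjoint.\<close>

lemma critical_event_unique:
  assumes "finite M" "M \<noteq> {}" "S \<subseteq> M" "\<omega> \<in> critical_event M S"
  shows "critical_set M \<omega> = S" and "dec (\<omega> ` S) = dec (\<omega> ` M)"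
proof -
  have "\<omega> ` M \<subseteq> space P"
    using assms(4) by (auto simp: critical_event_def space_PiM)
  moreover have "\<not> crit (dec (\<omega> ` S)) s" if "s \<in> \<omega> ` M - \<omega> ` S" for s
    using that assms(4) by (auto simp: critical_event_def)
  ultimately show eq: "dec (\<omega> ` S) = dec (\<omega> ` M)"
    using assms by (intro dec_extend[symmetric])
      (auto simp: critical_event_def self_critical_def)
  then show "critical_set M \<omega> = S"
    using assms(3,4) by (auto simp: critical_event_def self_critical_def critical_set_def)
qed

text \<open>The counterpart by \<open>dec_prune\<close>: every sample point lies in the event of its
  own critical set, so the events cover the space.\<close>

lemma critical_event_critical_set:
  assumes "finite M" "M \<noteq> {}" "\<omega> \<in> space (Pi\<^sub>M M (\<lambda>_. P))"
  shows "\<omega> \<in> critical_event M (critical_set M \<omega>)"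
proof -
  let ?S = "critical_set M \<omega>"
  have S: "?S \<subseteq> M"
    by (auto simp: critical_set_def)
  have "\<omega> ` M \<subseteq> space P"
    using assms(3) by (auto simp: space_PiM)
  moreover have "\<not> crit (dec (\<omega> ` M)) s" if "s \<in> \<omega> ` M - \<omega> ` ?S" for s
    using that by (auto simp: critical_set_def)
  ultimately have "(\<omega> ` ?S \<noteq> {} \<or> ok) \<and> dec (\<omega> ` ?S) = dec (\<omega> ` M)"
    using assms S by (intro dec_prune) auto
  then show ?thesis
    using assms(3) by (auto simp: critical_event_def self_critical_def critical_set_def)
qed

text \<open>The critical events of the subsets of \<open>{1..n}\<close> are disjoint, and the
  \<open>n choose m\<close> events with \<open>card S = m\<close> are equally probable.\<close>

lemma sum_moment_le_1:
  "(\<Sum>m\<le>n. of_nat (n choose m) * moment {1..m} (\<lambda>t. ennreal (t ^ (n - m)))) \<le> 1"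
proof -
  let ?M = "{1..n}"
  interpret PM: prob_space "Pi\<^sub>M ?M (\<lambda>_. P)"
    by (rule prob_space_PiM) (rule prob_space_axioms)
  have mom: "emeasure (Pi\<^sub>M ?M (\<lambda>_. P)) (critical_event ?M S)
      = moment {1..card S} (\<lambda>t. ennreal (t ^ (n - card S)))"
    and sets: "critical_event ?M S \<in> sets (Pi\<^sub>M ?M (\<lambda>_. P))" if "S \<subseteq> ?M" for S
  proof -
    have "finite S"
      using that finite_subset by blast
    then have "moment S (\<lambda>t. ennreal (t ^ (n - card S)))
        = moment {1..card S} (\<lambda>t. ennreal (t ^ (n - card S)))"
      by (intro moment_cong_card) auto
    then show "emeasure (Pi\<^sub>M ?M (\<lambda>_. P)) (critical_event ?M S)
      = moment {1..card S} (\<lambda>t. ennreal (t ^ (n - card S)))"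
      using emeasure_critical_event[of ?M S UNIV] that by simp
    show "critical_event ?M S \<in> sets (Pi\<^sub>M ?M (\<lambda>_. P))"
      using critical_event_sets[of ?M S UNIV] that by simp
  qed
  have "(\<Sum>m\<le>n. of_nat (n choose m) * moment {1..m} (\<lambda>t. ennreal (t ^ (n - m))))
    = (\<Sum>m\<le>n. \<Sum>S | S \<in> Pow ?M \<and> card S = m. emeasure (Pi\<^sub>M ?M (\<lambda>_. P)) (critical_event ?M S))"
  proof (rule sum.cong)
    fix m
    have "(\<Sum>S | S \<in> Pow ?M \<and> card S = m. emeasure (Pi\<^sub>M ?M (\<lambda>_. P)) (critical_event ?M S))
      = (\<Sum>S | S \<in> Pow ?M \<and> card S = m. moment {1..m} (\<lambda>t. ennreal (t ^ (n - m))))"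
      by (rule sum.cong) (auto simp: mom simp del: One_nat_def)
    then show "of_nat (n choose m) * moment {1..m} (\<lambda>t. ennreal (t ^ (n - m)))
      = (\<Sum>S | S \<in> Pow ?M \<and> card S = m. emeasure (Pi\<^sub>M ?M (\<lambda>_. P)) (critical_event ?M S))"
      by (simp add: n_subsets)
  qed simp
  also have "\<dots> = (\<Sum>S\<in>Pow ?M. emeasure (Pi\<^sub>M ?M (\<lambda>_. P)) (critical_event ?M S))"
    by (intro sum.group) (auto dest: card_mono[rotated])
  also have "\<dots> = emeasure (Pi\<^sub>M ?M (\<lambda>_. P)) (\<Union>S\<in>Pow ?M. critical_event ?M S)"
  proof (rule sum_emeasure)
    show "disjoint_family_on (critical_event ?M) (Pow ?M)"
    \<comment> \<open>Disjointness rests on \<open>dec_extend\<close>, which requires a nonempty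
      sample set; without samples there is only one event.\<close>
    proof (cases "n = 0")
      case False
      then have M: "finite ?M" "?M \<noteq> {}"
        by auto
      then show ?thesis
        using critical_event_unique(1)[of ?M] unfolding disjoint_family_on_def
        by (metis M PowD disjoint_iff)
    qed (auto simp: disjoint_family_on_def)
  qed (use sets in auto)
  also have "\<dots> \<le> 1"
    by (rule PM.emeasure_le_1)
  finally show ?thesis .
qed

text \<open>\<open>R m\<close> collects the unwanted values of \<open>safe\<close> when
  \<open>m\<close> samples are critical. Integrating \<open>bound\<close> against the measure for
  each \<open>m\<close> and summing over \<open>m\<close> bounds the probability of
  \<open>Bad\<close> by a combination, with weights \<open>c M\<close>, of the left-hand sides of
  \<open>sum_moment_le_1\<close>. These weights act as a dual certificate.\<close>

lemma scenario_risk: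
  fixes R :: "nat \<Rightarrow> real set" and c :: "nat \<Rightarrow> real"
  assumes n: "1 \<le> n" and \<M>: "finite \<M>" and c: "\<And>M. 0 \<le> c M"
    and R[measurable]: "\<And>m. R m \<in> sets borel"
    and bound: "\<And>m t. \<lbrakk>m \<le> n; 0 \<le> t; t \<le> 1; t \<in> R m\<rbrakk> \<Longrightarrow>
      real (n choose m) * t ^ (n - m) \<le> (\<Sum>M\<in>\<M>. c M * (real (M choose m) * t ^ (M - m)))"
  defines "Bad \<equiv> {\<omega> \<in> space (Pi\<^sub>M {1..n} (\<lambda>_. P)).
    safe (dec (\<omega> ` {1..n})) \<in> R (card (critical_set {1..n} \<omega>))}"
  shows "Bad \<in> sets (Pi\<^sub>M {1..n} (\<lambda>_. P))"
    and "emeasure (Pi\<^sub>M {1..n} (\<lambda>_. P)) Bad \<le> ennreal (\<Sum>M\<in>\<M>. c M)"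
proof -
  let ?M = "{1..n}"
  \<comment> \<open>The part of \<open>Bad\<close> whose critical set is \<open>S\<close>. It is
    written with the decision from \<open>S\<close> alone, which there agrees with the full one, so
    that \<open>emeasure_critical_event\<close> applies.\<close>
  define E where "E S = {\<omega> \<in> critical_event ?M S. safe (dec (\<omega> ` S)) \<in> R (card S)}" for S
  have M: "finite ?M" "?M \<noteq> {}"
    using n by auto
  have Bad: "Bad = (\<Union>S\<in>Pow ?M. E S)"
  proof (intro equalityI subsetI)
    fix \<omega> assume "\<omega> \<in> Bad"
    then have \<omega>: "\<omega> \<in> space (Pi\<^sub>M ?M (\<lambda>_. P))"
      and r: "safe (dec (\<omega> ` ?M)) \<in> R (card (critical_set ?M \<omega>))"
      by (auto simp: Bad_def)
    have sub: "critical_set ?M \<omega> \<subseteq> ?M"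
      by (auto simp: critical_set_def)
    note ev = critical_event_critical_set[OF M \<omega>]
    have "\<omega> \<in> E (critical_set ?M \<omega>)"
      using ev r critical_event_unique(2)[OF M sub ev] by (simp add: E_def)
    then show "\<omega> \<in> (\<Union>S\<in>Pow ?M. E S)"
      using sub by blast
  next
    fix \<omega> assume "\<omega> \<in> (\<Union>S\<in>Pow ?M. E S)"
    then obtain S where S: "S \<subseteq> ?M" and e: "\<omega> \<in> critical_event ?M S"
      and r: "safe (dec (\<omega> ` S)) \<in> R (card S)"
      by (auto simp: E_def)
    show "\<omega> \<in> Bad"
      using e r critical_event_unique[OF M S e] by (simp add: Bad_def critical_event_def)
  qed
  have E_sets: "E S \<in> sets (Pi\<^sub>M ?M (\<lambda>_. P))" if "S \<subseteq> ?M" for S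
    unfolding E_def by (rule critical_event_sets[OF M(1) that R])
  show "Bad \<in> sets (Pi\<^sub>M ?M (\<lambda>_. P))"
    unfolding Bad using E_sets by (intro sets.finite_UN) auto
  define H where "H M = (\<lambda>m. moment {1..m} (\<lambda>t. ennreal (t ^ (M - m))))" for M
  have "emeasure (Pi\<^sub>M ?M (\<lambda>_. P)) Bad \<le> (\<Sum>S\<in>Pow ?M. emeasure (Pi\<^sub>M ?M (\<lambda>_. P)) (E S))"
    unfolding Bad using E_sets by (intro emeasure_subadditive_finite) auto
  also have "\<dots> = (\<Sum>m\<le>n. \<Sum>S | S \<in> Pow ?M \<and> card S = m. emeasure (Pi\<^sub>M ?M (\<lambda>_. P)) (E S))"
    by (intro sum.group[symmetric]) (auto dest: card_mono[rotated])
  also have "\<dots> = (\<Sum>m\<le>n. of_nat (n choose m)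
      * moment {1..m} (\<lambda>t. indicator (R m) t * ennreal (t ^ (n - m))))"
  proof (rule sum.cong)
    fix m
    have "emeasure (Pi\<^sub>M ?M (\<lambda>_. P)) (E S)
      = moment {1..m} (\<lambda>t. indicator (R m) t * ennreal (t ^ (n - m)))"
      if "S \<subseteq> ?M" "card S = m" for S
    proof -
      have "finite S"
        using that finite_subset by blast
      have "emeasure (Pi\<^sub>M ?M (\<lambda>_. P)) (E S)
        = moment S (\<lambda>t. indicator (R m) t * ennreal (t ^ (n - m)))"
        using emeasure_critical_event[OF M(1) that(1) R, of "card S"] that(2) by (simp add: E_def)
      also have "\<dots> = moment {1..m} (\<lambda>t. indicator (R m) t * ennreal (t ^ (n - m)))"
        using \<open>finite S\<close> that by (intro moment_cong_card) auto
      finally show ?thesis .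
    qed
    then show "(\<Sum>S | S \<in> Pow ?M \<and> card S = m. emeasure (Pi\<^sub>M ?M (\<lambda>_. P)) (E S))
      = of_nat (n choose m) * moment {1..m} (\<lambda>t. indicator (R m) t * ennreal (t ^ (n - m)))"
      by (simp add: n_subsets)
  qed simp
  also have "\<dots> \<le> (\<Sum>m\<le>n. \<Sum>M\<in>\<M>. ennreal (c M) * (of_nat (M choose m) * H M m))"
  proof (rule sum_mono)
    fix m assume "m \<in> {..n}"
    then have m: "m \<le> n"
      by simp
    have "of_nat (n choose m) * moment {1..m} (\<lambda>t. indicator (R m) t * ennreal (t ^ (n - m)))
      = (\<integral>\<^sup>+\<omega>. of_nat (n choose m) * (indicator {\<omega>. self_critical {1..m} \<omega>} \<omega>
          * (indicator (R m) (safe (dec (\<omega> ` {1..m})))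
            * ennreal (safe (dec (\<omega> ` {1..m})) ^ (n - m)))) \<partial>Pi\<^sub>M {1..m} (\<lambda>_. P))"
      unfolding moment_def
      by (rule nn_integral_cmult[symmetric],
        rule moment_measurable[of _ "\<lambda>t. indicator (R m) t * ennreal (t ^ (n - m))"]) auto
    also have "\<dots> \<le> (\<integral>\<^sup>+\<omega>. (\<Sum>M\<in>\<M>. ennreal (c M) * (of_nat (M choose m) *
        (indicator {\<omega>. self_critical {1..m} \<omega>} \<omega> * ennreal (safe (dec (\<omega> ` {1..m})) ^ (M - m)))))
        \<partial>Pi\<^sub>M {1..m} (\<lambda>_. P))"
    proof (rule nn_integral_mono)
      fix \<omega>
      define t where "t = safe (dec (\<omega> ` {1..m}))"
      have t: "0 \<le> t" "t \<le> 1"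
        by (auto simp: t_def safe_bounds)
      have "of_nat (n choose m) * ennreal (t ^ (n - m))
        \<le> (\<Sum>M\<in>\<M>. ennreal (c M) * (of_nat (M choose m) * ennreal (t ^ (M - m))))" if "t \<in> R m"
      proof -
        have "of_nat (n choose m) * ennreal (t ^ (n - m)) = ennreal (real (n choose m) * t ^ (n - m))"
          using t by (simp add: ennreal_mult ennreal_of_nat_eq_real_of_nat)
        also have "\<dots> \<le> ennreal (\<Sum>M\<in>\<M>. c M * (real (M choose m) * t ^ (M - m)))"
          by (intro ennreal_leI bound m t that)
        also have "\<dots> = (\<Sum>M\<in>\<M>. ennreal (c M * (real (M choose m) * t ^ (M - m))))"
          using t c by (intro sum_ennreal[symmetric]) auto
        also have "\<dots> = (\<Sum>M\<in>\<M>. ennreal (c M) * (of_nat (M choose m) * ennreal (t ^ (M - m))))"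
          using t c by (simp add: ennreal_mult ennreal_of_nat_eq_real_of_nat)
        finally show ?thesis .
      qed
      then show "of_nat (n choose m) * (indicator {\<omega>. self_critical {1..m} \<omega>} \<omega>
          * (indicator (R m) (safe (dec (\<omega> ` {1..m})))
            * ennreal (safe (dec (\<omega> ` {1..m})) ^ (n - m))))
        \<le> (\<Sum>M\<in>\<M>. ennreal (c M) * (of_nat (M choose m) *
        (indicator {\<omega>. self_critical {1..m} \<omega>} \<omega> * ennreal (safe (dec (\<omega> ` {1..m})) ^ (M - m)))))"
        unfolding t_def[symmetric] by (auto simp: indicator_def)
    qed
    also have "\<dots> = (\<Sum>M\<in>\<M>. \<integral>\<^sup>+\<omega>. ennreal (c M) * (of_nat (M choose m) *
        (indicator {\<omega>. self_critical {1..m} \<omega>} \<omega> * ennreal (safe (dec (\<omega> ` {1..m})) ^ (M - m))))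
        \<partial>Pi\<^sub>M {1..m} (\<lambda>_. P))"
      by (intro nn_integral_sum borel_measurable_times_ennreal borel_measurable_const
          moment_measurable[where h = "\<lambda>t. ennreal (t ^ k)" for k]) auto
    also have "\<dots> = (\<Sum>M\<in>\<M>. ennreal (c M) * (of_nat (M choose m) * H M m))"
    proof (rule sum.cong)
      fix M
      have meas: "(\<lambda>\<omega>. indicator {\<omega>. self_critical {1..m} \<omega>} \<omega> * ennreal (safe (dec (\<omega> ` {1..m})) ^ (M - m)))
        \<in> borel_measurable (Pi\<^sub>M {1..m} (\<lambda>_. P))"
        by (rule moment_measurable[where h = "\<lambda>t. ennreal (t ^ (M - m))"]) auto
      show "(\<integral>\<^sup>+\<omega>. ennreal (c M) * (of_nat (M choose m) *
        (indicator {\<omega>. self_critical {1..m} \<omega>} \<omega> * ennreal (safe (dec (\<omega> ` {1..m})) ^ (M - m))))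
        \<partial>Pi\<^sub>M {1..m} (\<lambda>_. P)) = ennreal (c M) * (of_nat (M choose m) * H M m)"
        using meas by (simp add: nn_integral_cmult H_def moment_def)
    qed simp
    finally show "of_nat (n choose m) * moment {1..m} (\<lambda>t. indicator (R m) t * ennreal (t ^ (n - m)))
      \<le> (\<Sum>M\<in>\<M>. ennreal (c M) * (of_nat (M choose m) * H M m))" .
  qed
  also have "\<dots> = (\<Sum>M\<in>\<M>. ennreal (c M) * (\<Sum>m\<le>n. of_nat (M choose m) * H M m))"
    by (subst sum.swap) (simp add: sum_distrib_left)
  also have "\<dots> \<le> (\<Sum>M\<in>\<M>. ennreal (c M) * 1)"
  proof (intro sum_mono mult_left_mono)
    fix M
    \<comment> \<open>For m > M the exponent \<open>M - m\<close> is truncated to 0, but the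
      binomial coefficient vanishes. The remaining terms are part of the sum for \<open>M\<close>
      samples, whether \<open>M\<close> is smaller or larger than \<open>n\<close>.\<close>
    have "(\<Sum>m\<le>n. of_nat (M choose m) * H M m) = (\<Sum>m\<in>{..n} \<inter> {..M}. of_nat (M choose m) * H M m)"
      by (intro sum.mono_neutral_right) auto
    also have "\<dots> \<le> (\<Sum>m\<le>M. of_nat (M choose m) * H M m)"
      by (intro sum_mono2) auto
    also have "\<dots> \<le> 1"
      unfolding H_def by (rule sum_moment_le_1)
    finally show "(\<Sum>m\<le>n. of_nat (M choose m) * H M m) \<le> 1" .
  qed auto
  also have "\<dots> = ennreal (\<Sum>M\<in>\<M>. c M)"
    using c by (simp add: sum_ennreal)
  finally show "emeasure (Pi\<^sub>M ?M (\<lambda>_. P)) Bad \<le> ennreal (\<Sum>M\<in>\<M>. c M)" .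
qed

end

subsection \<open>The polynomial equations\<close>

text \<open>After division by \<open>t ^ n\<close>, three zeros mean that a sum of powers takes the
  value \<open>A\<close> three times. By Rolle its derivative vanishes at two points, yet this
  derivative is strictly increasing on the positive reals, the strictness coming from the negative
  exponent of the term \<open>j0\<close>.\<close>

lemma no_three_positive_zeros:
  fixes A :: real and c :: "nat \<Rightarrow> real"
  assumes J: "finite J" "\<And>j. 0 \<le> c j" "j0 \<in> J" "j0 < n" "0 < c j0"
    and x: "0 < x" "x < y" "y < z"
    and zero: "\<And>t. t \<in> {x, y, z} \<Longrightarrow> A * t ^ n = (\<Sum>j\<in>J. c j * t ^ j)"
  shows False
proof -
  \<comment> \<open>Exponents after the division; they can be negative, hence the use of
    \<open>powr\<close>.\<close>
  define e where "e j = real j - real n" for j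
  define g where "g t = (\<Sum>j\<in>J. c j * t powr e j)" for t
  define g' where "g' t = (\<Sum>j\<in>J. c j * (e j * t powr (e j - 1)))" for t
  have g_A: "g t = A" if "t \<in> {x, y, z}" for t
  proof -
    have t: "0 < t"
      using that x by auto
    have pw: "t powr e j * t ^ n = t ^ j" for j
    proof -
      have "t powr e j * t ^ n = t powr (e j + real n)"
        using t by (simp add: powr_add powr_realpow)
      also have "\<dots> = t ^ j"
        using t by (simp add: e_def powr_realpow)
      finally show ?thesis .
    qed
    have "g t * t ^ n = (\<Sum>j\<in>J. c j * t ^ j)"
      by (simp add: g_def sum_distrib_right mult.assoc pw)
    then have "g t * t ^ n = A * t ^ n"
      using zero[OF that] by simp
    then show ?thesis
      using t by simp
  qed
  have deriv: "(g has_real_derivative g' t) (at t)" if "0 < t" for t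
    unfolding g_def g'_def using that
    by (auto intro!: derivative_eq_intros sum.cong)
  have rolle: "\<exists>t. a < t \<and> t < b \<and> g' t = 0" if ab: "0 < a" "a < b" "g a = g b" for a b
  proof -
    have "continuous_on {a..b} g"
      by (rule DERIV_continuous_on[of _ _ g']) (use deriv ab(1) in \<open>simp add: has_field_derivative_at_within\<close>)
    moreover have "g differentiable (at t)" if "a < t" "t < b" for t
      using deriv[of t] \<open>0 < a\<close> that by (auto simp: real_differentiable_def)
    ultimately obtain t where t: "a < t" "t < b" "DERIV g t :> 0"
      using Rolle[OF ab(2,3)] by blast
    moreover have "g' t = 0"
      using DERIV_unique[OF deriv t(3)] t(1) ab(1) by simp
    ultimately show ?thesis
      by blast
  qed
  obtain s where s: "x < s" "s < y" "g' s = 0"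
    using rolle[of x y] x g_A by auto
  obtain t where t: "y < t" "t < z" "g' t = 0"
    using rolle[of y z] x g_A by auto
  have st: "0 < s" "s < t"
    using s t x by auto
  \<comment> \<open>A negative exponent gives a decreasing power times a negative factor, exponent 0
    gives zero, and an exponent that is at least 1 gives a nondecreasing power times a positive
    factor.\<close>
  have summand: "e j * s powr (e j - 1) \<le> e j * t powr (e j - 1)" for j
  proof (cases "j < n")
    case True
    then have "t powr (e j - 1) \<le> s powr (e j - 1)"
      using st by (intro powr_mono2') (auto simp: e_def)
    then show ?thesis
      using True by (intro mult_left_mono_neg) (auto simp: e_def)
  next
    case False
    show ?thesis
    proof (cases "j = n")
      case False
      then have "1 \<le> e j"
        using \<open>\<not> j < n\<close> by (simp add: e_def)
      then show ?thesis
        using st by (intro mult_left_mono powr_mono2) auto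
    qed (simp add: e_def)
  qed
  have "t powr (e j0 - 1) < s powr (e j0 - 1)"
    using st J by (intro powr_less_mono2_neg) (auto simp: e_def)
  then have "e j0 * s powr (e j0 - 1) < e j0 * t powr (e j0 - 1)"
    using J by (intro mult_strict_left_mono_neg) (auto simp: e_def)
  then have "g' s < g' t"
    unfolding g'_def using J summand
    by (intro sum_strict_mono_ex1) (auto intro: mult_left_mono[OF summand] intro!: bexI[of _ j0])
  then show False
    using s t by simp
qed

text \<open>The ratio of consecutive terms is (i+1) t / (i+1-m). For t = 1 - m/N it is at least 1
  when i < N and at most 1 when i \<ge> N, so this \<open>t\<close> is chosen to put the maximum
  over \<open>i\<close> at \<open>N\<close>.\<close>

lemma binomial_mode:
  fixes t :: real
  assumes N: "m < N" and t: "t = (real N - real m) / real N" and i: "m \<le> i"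
  shows "real (i choose m) * t ^ (i - m) \<le> real (N choose m) * t ^ (N - m)"
proof -
  define s where "s i = real (i choose m) * t ^ (i - m)" for i
  have t0: "0 < t" "real N * t = real N - real m"
    using N by (auto simp: t)
  have step: "real (Suc i - m) * s (Suc i) = (real (Suc i) * t) * s i" if "m \<le> i" for i
  proof -
    have "(Suc i - m) * (Suc i choose m) = Suc i * (i choose m)"
      using binomial_absorb_comp[of "Suc i" m] by simp
    then have "real (Suc i - m) * real (Suc i choose m) = real (Suc i) * real (i choose m)"
      by (metis of_nat_mult)
    moreover have "t ^ (Suc i - m) = t * t ^ (i - m)"
      using that by (simp add: Suc_diff_le)
    ultimately show ?thesis
      unfolding s_def by (simp add: mult_ac)
  qed
  have nonneg: "0 \<le> s i" for i
    using t0 by (simp add: s_def)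
  have up: "s i \<le> s (Suc i)" if "m \<le> i" "i < N" for i
  proof -
    have "real N * real (Suc i - m) \<le> real (Suc i) * (real N - real m)"
    proof -
      have "real m * real (Suc i) \<le> real m * real N"
        using that by (intro mult_left_mono) auto
      then show ?thesis
        using that by (simp add: of_nat_diff algebra_simps)
    qed
    then have "real (Suc i - m) \<le> real (Suc i) * t"
      using N by (simp add: t field_simps)
    then have "real (Suc i - m) * s i \<le> real (Suc i - m) * s (Suc i)"
      unfolding step[OF that(1)] by (rule mult_right_mono[OF _ nonneg])
    moreover have "0 < real (Suc i - m)"
      using that by simp
    ultimately show ?thesis
      by (simp only: mult_le_cancel_left_pos)
  qed
  have down: "s (Suc i) \<le> s i" if "N \<le> i" for i
  proof -
    have "real (Suc i) * (real N - real m) \<le> real N * real (Suc i - m)"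
    proof -
      have "real m * real N \<le> real m * real (Suc i)"
        using that by (intro mult_left_mono) auto
      then show ?thesis
        using that N by (simp add: of_nat_diff algebra_simps)
    qed
    then have "real (Suc i) * t \<le> real (Suc i - m)"
      using N by (simp add: t field_simps)
    then have "real (Suc i - m) * s (Suc i) \<le> real (Suc i - m) * s i"
      using step[of i] that N by (simp only: mult_right_mono[OF _ nonneg])
    moreover have "0 < real (Suc i - m)"
      using that N by simp
    ultimately show ?thesis
      by (simp only: mult_le_cancel_left_pos)
  qed
  have "s i \<le> s N"
  proof (cases "i \<le> N")
    case True
    then show ?thesis
      using i
    proof (induction i rule: inc_induct)
      case (step k)
      then show ?case
        using up[of k] by simp
    qed simp
  next
    case False
    then have "N \<le> i"
      by simp
    then show ?thesis
    proof (induction i rule: dec_induct)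
      case (step k)
      then show ?case
        using down[of k] by simp
    qed simp
  qed
  then show ?thesis
    by (simp add: s_def)
qed

text \<open>The sign pattern minus, plus, minus forces two zeros by the intermediate value theorem,
  and \<open>three\<close> excludes more. The same argument places a zero on either side of any
  point where \<open>p\<close> is positive; contraposed, \<open>p\<close> is not positive outside
  the interval between the zeros.\<close>

lemma card_two_zeros:
  fixes p :: "real \<Rightarrow> real"
  assumes cont: "continuous_on {0..} p"
    and p0: "p 0 < 0" and t0: "0 < t0" "0 < p t0" and T: "\<And>t. T \<le> t \<Longrightarrow> p t < 0"
    and three: "\<And>x y z. \<lbrakk>0 < x; x < y; y < z; p x = 0; p y = 0; p z = 0\<rbrakk> \<Longrightarrow> False"
  defines "Z \<equiv> {t. 0 \<le> t \<and> p t = 0}"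
  shows "card Z = 2" and "\<And>t. \<lbrakk>0 \<le> t; 0 < p t\<rbrakk> \<Longrightarrow> Min Z \<le> t \<and> t \<le> Max Z"
proof -
  have left: "\<exists>x\<in>Z. x < t" if "0 \<le> t" "0 < p t" for t
  proof -
    have "\<exists>x. 0 \<le> x \<and> x \<le> t \<and> p x = 0"
      using p0 that cont by (intro IVT') (auto intro: continuous_on_subset)
    then show ?thesis
      using that(2) unfolding Z_def by (metis (mono_tags, lifting) less_irrefl mem_Collect_eq order_le_less)
  qed
  have right: "\<exists>x\<in>Z. t < x" if "0 \<le> t" "0 < p t" for t
  proof -
    have "\<exists>x. t \<le> x \<and> x \<le> max t T \<and> p x = 0"
      using T[of "max t T"] that cont
      by (intro IVT2') (auto intro: continuous_on_subset)
    then show ?thesis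
      using that unfolding Z_def
      by (metis (mono_tags, lifting) less_irrefl mem_Collect_eq order.trans order_le_less)
  qed
  obtain x y where xy: "x \<in> Z" "x < t0" "y \<in> Z" "t0 < y"
    using left[of t0] right[of t0] t0 by auto
  have pos: "0 < x" if "x \<in> Z" for x
    using that p0 unfolding Z_def by (metis (mono_tags) less_eq_real_def less_irrefl mem_Collect_eq)
  have three': False if "a \<in> Z" "b \<in> Z" "c \<in> Z" "a < b" "b < c" for a b c
    using three[of a b c] that pos[of a] by (auto simp: Z_def)
  have "z \<in> {x, y}" if z: "z \<in> Z" for z
  proof (rule ccontr)
    assume "z \<notin> {x, y}"
    then consider "z < x" | "x < z" "z < y" | "y < z"
      using xy by fastforce
    then show False
      using three' xy z by cases (meson less_trans)+
  qed
  then have Z: "Z = {x, y}"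
    using xy by auto
  then show "card Z = 2"
    using xy by auto
  show "Min Z \<le> t \<and> t \<le> Max Z" if t: "0 \<le> t" "0 < p t" for t
  proof -
    have fin: "finite Z"
      using Z by simp
    obtain a b where "a \<in> Z" "a < t" "b \<in> Z" "t < b"
      using left[OF t] right[OF t] by auto
    then show ?thesis
      using Min_le[OF fin, of a] Max_ge[OF fin, of b] by linarith
  qed
qed

section \<open>Roots and signs of the polynomials\<close>

definition eps_poly :: "nat \<Rightarrow> real \<Rightarrow> nat \<Rightarrow> real \<Rightarrow> real" where
  "eps_poly N \<delta> m t = real (N choose m) * t ^ (N - m)
     - \<delta> / (2 * real N) * (\<Sum>i\<in>{m..<N}. real (i choose m) * t ^ (i - m))
     - \<delta> / (6 * real N) * (\<Sum>i=N+1..4*N. real (i choose m) * t ^ (i - m))"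

text \<open>One expression serves both branches of \<open>eps_equation\<close>: for m = N the first
  sum of \<open>eps_poly\<close> is empty and the leading term is 1.\<close>

lemma eps_equation_iff:
  assumes "1 \<le> N" "m \<le> N"
  shows "eps_equation N \<delta> m t \<longleftrightarrow> eps_poly N \<delta> m t = 0"
proof -
  have "{m..N - 1} = {m..<N}"
    using assms by auto
  then show ?thesis
    using assms by (auto simp: eps_equation_def eps_poly_def)
qed

lemma eps_roots_eq:
  assumes "1 \<le> N" "m \<le> N"
  shows "eps_roots N \<delta> m = {t. 0 \<le> t \<and> eps_poly N \<delta> m t = 0}"
  using eps_equation_iff[OF assms] by (simp add: eps_roots_def)

lemma continuous_on_eps_poly: "continuous_on A (eps_poly N \<delta> m)"
  unfolding eps_poly_def by (intro continuous_intros)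

text \<open>The single summand i = 4N already beats the leading term: its exponent is larger by at
  least one and its binomial coefficient is no smaller. The threshold makes one further factor
  \<open>t\<close> outweigh the weight \<delta>/(6N).\<close>

lemma eps_poly_eventually_neg:
  assumes N: "1 \<le> N" "m \<le> N" and \<delta>: "0 < \<delta>" and t: "1 + 6 * real N / \<delta> \<le> t"
  shows "eps_poly N \<delta> m t < 0"
proof -
  have "0 < 6 * real N / \<delta>"
    using N \<delta> by simp
  then have t1: "1 \<le> t" "6 * real N / \<delta> < t"
    using t by linarith+
  then have "1 < \<delta> / (6 * real N) * t"
    using N \<delta> by (simp add: field_simps)
  moreover have "0 < real (N choose m) * t ^ (N - m)"
    using N t1 by simp
  ultimately have "real (N choose m) * t ^ (N - m) < \<delta> / (6 * real N) * t * (real (N choose m) * t ^ (N - m))"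
    using mult_strict_right_mono[of 1 "\<delta> / (6 * real N) * t" "real (N choose m) * t ^ (N - m)"] by simp
  also have "\<dots> = \<delta> / (6 * real N) * (real (N choose m) * t ^ Suc (N - m))"
    by simp
  also have "\<dots> \<le> \<delta> / (6 * real N) * (real (4 * N choose m) * t ^ (4 * N - m))"
    using N \<delta> t1 by (intro mult_left_mono mult_mono power_increasing of_nat_mono binomial_right_mono) auto
  also have "\<dots> \<le> \<delta> / (6 * real N) * (\<Sum>i=N+1..4*N. real (i choose m) * t ^ (i - m))"
    using N \<delta> t1
    by (intro mult_left_mono member_le_sum[where f = "\<lambda>i. real (i choose m) * t ^ (i - m)"]) auto
  finally have "real (N choose m) * t ^ (N - m)
    < \<delta> / (6 * real N) * (\<Sum>i=N+1..4*N. real (i choose m) * t ^ (i - m))" .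
  moreover have "0 \<le> \<delta> / (2 * real N) * (\<Sum>i\<in>{m..<N}. real (i choose m) * t ^ (i - m))"
    using \<delta> t1 by (intro mult_nonneg_nonneg sum_nonneg) auto
  ultimately show ?thesis
    by (simp add: eps_poly_def)
qed

text \<open>At this \<open>t\<close> the leading term \<open>C\<close> dominates every summand by
  \<open>binomial_mode\<close>. At most N summands of weight \<delta>/(2N) and 3N summands of weight
  \<delta>/(6N) subtract at most \<delta>/2 \<open>C\<close> each time, in total less than
  \<open>C\<close>.\<close>

lemma eps_poly_pos:
  assumes m: "m < N" and \<delta>: "0 < \<delta>" "\<delta> < 1" and t: "t = (real N - real m) / real N"
  shows "0 < eps_poly N \<delta> m t"
proof -
  define C where "C = real (N choose m) * t ^ (N - m)"
  have "0 < t"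
    using m by (simp add: t)
  then have C: "0 < C"
    using m by (simp add: C_def)
  have le: "real (i choose m) * t ^ (i - m) \<le> C" if "m \<le> i" for i
    unfolding C_def by (rule binomial_mode[OF m t that])
  have "(\<Sum>i\<in>{m..<N}. real (i choose m) * t ^ (i - m)) \<le> of_nat (card {m..<N}) * C"
    using le by (intro sum_bounded_above) auto
  also have "\<dots> \<le> real N * C"
    using C by (intro mult_right_mono) auto
  finally have "\<delta> / (2 * real N) * (\<Sum>i\<in>{m..<N}. real (i choose m) * t ^ (i - m))
      \<le> \<delta> / (2 * real N) * (real N * C)"
    using \<delta> by (intro mult_left_mono) auto
  also have "\<dots> = \<delta> / 2 * C"
    using m by (simp add: field_simps)
  finally have 1: "\<delta> / (2 * real N) * (\<Sum>i\<in>{m..<N}. real (i choose m) * t ^ (i - m)) \<le> \<delta> / 2 * C" .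
  have "(\<Sum>i=N+1..4*N. real (i choose m) * t ^ (i - m)) \<le> of_nat (card {N+1..4*N}) * C"
    using le m by (intro sum_bounded_above) auto
  then have "\<delta> / (6 * real N) * (\<Sum>i=N+1..4*N. real (i choose m) * t ^ (i - m))
      \<le> \<delta> / (6 * real N) * (3 * real N * C)"
    using \<delta> by (intro mult_left_mono) auto
  also have "\<dots> = \<delta> / 2 * C"
    using m by (simp add: field_simps)
  finally have 2: "\<delta> / (6 * real N) * (\<Sum>i=N+1..4*N. real (i choose m) * t ^ (i - m)) \<le> \<delta> / 2 * C" .
  have "\<delta> * C < C"
    using C \<delta> by simp
  then show ?thesis
    using 1 2 unfolding eps_poly_def C_def[symmetric] by simp
qed

lemma eps_poly_0:
  assumes "m < N" "0 < \<delta>"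
  shows "eps_poly N \<delta> m 0 < 0"
proof -
  \<comment> \<open>At 0 only the summand i = m survives, because \<open>0 ^ 0 = 1\<close>; the
    value of the polynomial is - \<delta>/(2N).\<close>
  have "(\<Sum>i\<in>{m..<N}. real (i choose m) * 0 ^ (i - m)) = (\<Sum>i\<in>{m}. real (i choose m) * 0 ^ (i - m))"
    using assms by (intro sum.mono_neutral_right) auto
  moreover have "(\<Sum>i=N+1..4*N. real (i choose m) * 0 ^ (i - m)) = 0"
    using assms by (intro sum.neutral) auto
  ultimately show ?thesis
    using assms by (simp add: eps_poly_def power_0_left)
qed

text \<open>Divided by \<open>t ^ (N - m)\<close>, the polynomial becomes a constant minus a strictly convex function.\<close>

lemma eps_poly_no_three_zeros:
  assumes m: "m < N" and \<delta>: "0 < \<delta>"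
    and x: "0 < x" "x < y" "y < z"
    and zero: "eps_poly N \<delta> m x = 0" "eps_poly N \<delta> m y = 0" "eps_poly N \<delta> m z = 0"
  shows False
proof -
  define c where "c j = (if j + m < N then \<delta> / (2 * real N) else \<delta> / (6 * real N))
    * real ((j + m) choose m)" for j
  define J where "J = {0..<N - m} \<union> {N + 1 - m..4 * N - m}"
  have eq: "(\<Sum>j\<in>J. c j * t ^ j) = real (N choose m) * t ^ (N - m) - eps_poly N \<delta> m t" for t
  proof -
    have "(\<Sum>j\<in>J. c j * t ^ j) = (\<Sum>j\<in>{0..<N - m}. c j * t ^ j) + (\<Sum>j\<in>{N + 1 - m..4 * N - m}. c j * t ^ j)"
      unfolding J_def by (rule sum.union_disjoint) auto
    also have "(\<Sum>j\<in>{0..<N - m}. c j * t ^ j)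
      = (\<Sum>i\<in>{m..<N}. \<delta> / (2 * real N) * (real (i choose m) * t ^ (i - m)))"
      using m by (intro sum.reindex_bij_witness[of _ "\<lambda>i. i - m" "\<lambda>j. j + m"]) (auto simp: c_def)
    also have "(\<Sum>j\<in>{N + 1 - m..4 * N - m}. c j * t ^ j)
      = (\<Sum>i=N+1..4*N. \<delta> / (6 * real N) * (real (i choose m) * t ^ (i - m)))"
      using m by (intro sum.reindex_bij_witness[of _ "\<lambda>i. i - m" "\<lambda>j. j + m"]) (auto simp: c_def)
    finally show ?thesis
      by (simp add: eps_poly_def sum_distrib_left)
  qed
  show False
  \<comment> \<open>Here \<open>j = i - m\<close>. The index 0 stems from i = m; its exponent lies
    below \<open>N - m\<close> and its coefficient \<delta>/(2N) is positive, which supplies the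
    strict convexity.\<close>
  proof (rule no_three_positive_zeros[where c = c and J = J and n = "N - m" and ?j0.0 = 0])
    show "real (N choose m) * t ^ (N - m) = (\<Sum>j\<in>J. c j * t ^ j)" if "t \<in> {x, y, z}" for t
      using that zero eq[of t] by auto
  qed (use x m \<delta> in \<open>auto simp: c_def J_def\<close>)
qed

lemma
  assumes m: "m < N" and \<delta>: "0 < \<delta>" "\<delta> < 1"
  shows card_eps_roots: "card (eps_roots N \<delta> m) = 2"
    and eps_poly_sign: "\<lbrakk>0 \<le> t; t < t_lower N \<delta> m \<or> t_upper N \<delta> m < t\<rbrakk> \<Longrightarrow> eps_poly N \<delta> m t \<le> 0"
proof -
  have N: "1 \<le> N" "m \<le> N"
    using m by auto
  have "0 < (real N - real m) / real N"
    using m by simp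
  note Z = card_two_zeros[OF continuous_on_eps_poly eps_poly_0[OF m \<delta>(1)] this
      eps_poly_pos[OF m \<delta> refl], of "1 + 6 * real N / \<delta>", folded eps_roots_eq[OF N]]
  show "card (eps_roots N \<delta> m) = 2"
    by (rule Z(1)) (use eps_poly_eventually_neg[OF N \<delta>(1)] eps_poly_no_three_zeros[OF m \<delta>(1)] in blast)+
  show "eps_poly N \<delta> m t \<le> 0" if t: "0 \<le> t" "t < t_lower N \<delta> m \<or> t_upper N \<delta> m < t"
  proof (rule ccontr)
    assume "\<not> eps_poly N \<delta> m t \<le> 0"
    then have pos: "0 < eps_poly N \<delta> m t"
      by simp
    have "Min (eps_roots N \<delta> m) \<le> t \<and> t \<le> Max (eps_roots N \<delta> m)"
      by (rule Z(2)[OF _ _ t(1) pos])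
        (use eps_poly_eventually_neg[OF N \<delta>(1)] eps_poly_no_three_zeros[OF m \<delta>(1)] in blast)+
    then show False
      using t m by (simp add: t_lower_def t_upper_def)
  qed
qed

lemma eps_poly_top_strict_antimono:
  assumes N: "1 \<le> N" and \<delta>: "0 < \<delta>" and st: "0 \<le> s" "s < t"
  shows "eps_poly N \<delta> N t < eps_poly N \<delta> N s"
proof -
  have "(\<Sum>i=N+1..4*N. real (i choose N) * s ^ (i - N)) < (\<Sum>i=N+1..4*N. real (i choose N) * t ^ (i - N))"
    using N st by (intro sum_strict_mono mult_strict_left_mono power_strict_mono) auto
  then show ?thesis
    using N \<delta> by (simp add: eps_poly_def divide_strict_right_mono)
qed

text \<open>For m = N the polynomial starts at 1 and strictly decreases to negative values, so there
  is one root and only its right-hand side has to be considered.\<close>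

lemma
  assumes N: "1 \<le> N" and \<delta>: "0 < \<delta>"
  shows eps_roots_top: "\<exists>!t. t \<in> eps_roots N \<delta> N"
    and eps_poly_top_sign: "t_upper N \<delta> N < t \<Longrightarrow> eps_poly N \<delta> N t \<le> 0"
proof -
  define T where "T = 1 + 6 * real N / \<delta>"
  have T: "0 \<le> T"
    using \<delta> by (simp add: T_def)
  have "(\<Sum>i=N+1..4*N. real (i choose N) * 0 ^ (i - N)) = 0"
    by (intro sum.neutral) auto
  then have "eps_poly N \<delta> N 0 = 1"
    by (simp add: eps_poly_def)
  moreover have "eps_poly N \<delta> N T < 0"
    using N \<delta> by (intro eps_poly_eventually_neg) (auto simp: T_def)
  ultimately have "\<exists>r\<ge>0. r \<le> T \<and> eps_poly N \<delta> N r = 0"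
    using T by (intro IVT2') (auto intro: continuous_on_eps_poly)
  then obtain r where r: "0 \<le> r" "eps_poly N \<delta> N r = 0"
    by auto
  have uniq: "s = r" if "0 \<le> s" "eps_poly N \<delta> N s = 0" for s
    using eps_poly_top_strict_antimono[OF N \<delta>, of s r] eps_poly_top_strict_antimono[OF N \<delta>, of r s]
      r that by (cases s r rule: linorder_cases) auto
  have roots: "eps_roots N \<delta> N = {r}"
    unfolding eps_roots_eq[OF N order_refl] using r uniq by blast
  then show "\<exists>!t. t \<in> eps_roots N \<delta> N"
    by simp
  show "eps_poly N \<delta> N t \<le> 0" if "t_upper N \<delta> N < t"
    using eps_poly_top_strict_antimono[OF N \<delta>, of r t] r that by (simp add: t_upper_def roots)
qed

text \<open>Outside the interval between the roots \<open>eps_poly\<close> is at most 0. Rearranged,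
  this is the inequality \<open>bound\<close> of \<open>scenario_risk\<close>, with the coefficients
  of the polynomial as weights.\<close>

lemma eps_bound_violated:
  assumes N: "1 \<le> N" and m: "m \<le> N" and \<delta>: "0 < \<delta>" "\<delta> < 1" and t: "0 \<le> t" "t \<le> 1"
    and out: "1 - t < eps_lower N \<delta> m \<or> eps_upper N \<delta> m < 1 - t"
  shows "real (N choose m) * t ^ (N - m) \<le> (\<Sum>M\<in>{0..<N} \<union> {N+1..4*N}.
    (if M < N then \<delta> / (2 * real N) else \<delta> / (6 * real N)) * (real (M choose m) * t ^ (M - m)))"
    (is "_ \<le> sum ?f _")
proof -
  \<comment> \<open>The maximum with 0 in \<open>eps_lower\<close> has no effect here, since 1 - t
    \<ge> 0.\<close>
  have out': "t < t_lower N \<delta> m \<or> t_upper N \<delta> m < t"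
    using out t by (auto simp: eps_lower_def eps_upper_def max_def split: if_splits)
  have neg: "eps_poly N \<delta> m t \<le> 0"
  proof (cases "m < N")
    case True
    then show ?thesis
      using eps_poly_sign[OF True \<delta>] t out' by simp
  next
    case False
    then have "m = N"
      using m by simp
    \<comment> \<open>For m = N the convention \<open>t_lower = 0\<close> rules out the left
      alternative.\<close>
    then show ?thesis
      using eps_poly_top_sign[OF N \<delta>(1)] t out' by (auto simp: t_lower_def)
  qed
  have "sum ?f ({0..<N} \<union> {N+1..4*N}) = sum ?f {0..<N} + sum ?f {N+1..4*N}"
    by (rule sum.union_disjoint) auto
  also have "sum ?f {0..<N} = sum ?f {m..<N}"
    using m by (intro sum.mono_neutral_right) auto
  also have "sum ?f {m..<N} = \<delta> / (2 * real N) * (\<Sum>i\<in>{m..<N}. real (i choose m) * t ^ (i - m))"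
    by (simp add: sum_distrib_left)
  also have "sum ?f {N+1..4*N} = \<delta> / (6 * real N) * (\<Sum>i=N+1..4*N. real (i choose m) * t ^ (i - m))"
    by (simp add: sum_distrib_left)
  finally show ?thesis
    using neg by (simp add: eps_poly_def)
qed

lemma eps_weights_sum:
  assumes "1 \<le> N"
  shows "(\<Sum>M\<in>{0..<N} \<union> {N+1..4*N}. if M < N then \<delta> / (2 * real N) else \<delta> / (6 * real N)) = \<delta>"
    (is "sum ?f _ = _")
proof -
  have "sum ?f ({0..<N} \<union> {N+1..4*N}) = sum ?f {0..<N} + sum ?f {N+1..4*N}"
    by (rule sum.union_disjoint) auto
  also have "\<dots> = real N * (\<delta> / (2 * real N)) + real (3 * N) * (\<delta> / (6 * real N))"
    by simp
  also have "\<dots> = \<delta>"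
    using assms by (simp add: field_simps)
  finally show ?thesis .
qed

subsection \<open>The optimisation program\<close>

text \<open>The \<open>x\<close>-components of the minimisers, that is, of the feasible points of
  objective value 0. A positive price forbids its sign of \<open>r $ k\<close>; if \<rho> > 0 the
  slacks must vanish and \<open>b\<close> stays below the sampled bounds, whereas for \<rho> = 0
  slack is free and these bounds disappear.\<close>

definition candidates ::
  "real \<Rightarrow> ('k::finite) rvec \<Rightarrow> 'k rvec \<Rightarrow> real \<Rightarrow> 'k rvec_pair set \<Rightarrow> 'k rvec_pair set" where
  "candidates rmax \<pi>p \<pi>m \<rho> A = {(r, b). \<forall>k. \<bar>r $ k\<bar> \<le> rmax \<and> (\<pi>p $ k = 0 \<or> r $ k \<le> 0)
     \<and> (\<pi>m $ k = 0 \<or> 0 \<le> r $ k) \<and> 0 \<le> b $ k \<and> (\<rho> = 0 \<or> (\<forall>s\<in>A. b $ k \<le> snd s $ k))}"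

definition critical ::
  "real \<Rightarrow> ('k::{finite,linorder}) rvec \<Rightarrow> 'k rvec_pair \<Rightarrow> 'k rvec_pair \<Rightarrow> bool" where
  "critical b0 q x s \<longleftrightarrow> (\<exists>k. snd x $ k \<le> prev_state b0 (snd x) k + q $ k + fst x $ k - fst s $ k
     \<or> snd s $ k \<le> snd x $ k)"

lemma cost_nonneg:
  assumes "\<And>k. 0 \<le> \<pi>p $ k" "\<And>k. 0 \<le> \<pi>m $ k"
  shows "0 \<le> cost \<pi>p \<pi>m r"
  unfolding cost_def using assms
  by (intro sum_nonneg add_nonneg_nonneg mult_nonneg_nonneg) (auto simp: pos_part_def neg_part_def)

lemma cost_eq_0_iff:
  assumes "\<And>k. 0 \<le> \<pi>p $ k" "\<And>k. 0 \<le> \<pi>m $ k"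
  shows "cost \<pi>p \<pi>m r = 0 \<longleftrightarrow> (\<forall>k. (\<pi>p $ k = 0 \<or> r $ k \<le> 0) \<and> (\<pi>m $ k = 0 \<or> 0 \<le> r $ k))"
proof -
  have nonneg: "0 \<le> \<pi>p $ k * pos_part (r $ k)" "0 \<le> \<pi>m $ k * neg_part (r $ k)" for k
    using assms by (intro mult_nonneg_nonneg; simp add: pos_part_def neg_part_def)+
  have "cost \<pi>p \<pi>m r = 0 \<longleftrightarrow> (\<forall>k\<in>UNIV. \<pi>p $ k * pos_part (r $ k) + \<pi>m $ k * neg_part (r $ k) = 0)"
    unfolding cost_def by (rule sum_nonneg_eq_0_iff[OF finite add_nonneg_nonneg[OF nonneg]])
  also have "\<dots> \<longleftrightarrow> (\<forall>k. \<pi>p $ k * pos_part (r $ k) = 0 \<and> \<pi>m $ k * neg_part (r $ k) = 0)"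
    by (simp only: add_nonneg_eq_0_iff[OF nonneg] ball_UNIV)
  also have "\<dots> \<longleftrightarrow> (\<forall>k. (\<pi>p $ k = 0 \<or> r $ k \<le> 0) \<and> (\<pi>m $ k = 0 \<or> 0 \<le> r $ k))"
  proof -
    have "pos_part a = 0 \<longleftrightarrow> a \<le> 0" "neg_part a = 0 \<longleftrightarrow> 0 \<le> a" for a
      by (auto simp: pos_part_def neg_part_def)
    then show ?thesis
      by simp
  qed
  finally show ?thesis .
qed

text \<open>Every constraint bounds \<open>u\<close> from below only, so a sufficiently large
  \<open>u\<close> meets all of them.\<close>

lemma feasible_exists_u:
  fixes \<omega> :: "nat \<Rightarrow> 'k::{finite,linorder} rvec_pair"
  assumes \<xi>: "\<xi> \<in> {1..M} \<rightarrow>\<^sub>E {0..}"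
    and x: "\<And>k. \<bar>r $ k\<bar> \<le> rmax" "\<And>k. 0 \<le> b $ k"
    and le: "\<And>k i. i \<in> {1..M} \<Longrightarrow> b $ k \<le> \<xi> i + snd (\<omega> i) $ k"
  shows "\<exists>u. (u, \<xi>, r, b) \<in> feasible b0 q rmax M \<omega>"
proof -
  \<comment> \<open>The sum over the samples is an upper bound for each single sample at once, and
    the absolute values cover either sign.\<close>
  define u :: "'k rvec" where
    "u = (\<chi> k. (\<Sum>i\<in>{1..M}. \<bar>fst (\<omega> i) $ k\<bar> + \<xi> i) + \<bar>prev_state b0 b k\<bar> + \<bar>q $ k\<bar> + \<bar>r $ k\<bar>)"
  have \<xi>0: "0 \<le> \<xi> i" if "i \<in> {1..M}" for i
    using \<xi> that by (auto simp: PiE_iff)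
  have summand: "\<bar>fst (\<omega> i) $ k\<bar> + \<xi> i \<le> (\<Sum>i\<in>{1..M}. \<bar>fst (\<omega> i) $ k\<bar> + \<xi> i)"
    if "i \<in> {1..M}" for i k
    using that \<xi>0 by (intro member_le_sum[where f = "\<lambda>i. \<bar>fst (\<omega> i) $ k\<bar> + \<xi> i"]) auto
  have u: "\<bar>fst (\<omega> i) $ k\<bar> + \<xi> i + \<bar>prev_state b0 b k\<bar> + \<bar>q $ k\<bar> + \<bar>r $ k\<bar> \<le> u $ k"
    if "i \<in> {1..M}" for i k
    using summand[OF that, of k] by (simp add: u_def)
  have "0 \<le> u $ k" for k
    using \<xi>0 by (auto simp: u_def intro!: add_nonneg_nonneg sum_nonneg)
  moreover have "(r $ k, b $ k) \<in> stage_set rmax (prev_state b0 b k) (q $ k)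
      (u $ k - \<xi> i) (\<xi> i + snd (\<omega> i) $ k) \<and> fst (\<omega> i) $ k \<le> u $ k" if "i \<in> {1..M}" for i k
    using u[OF that, of k] x[of k] le[OF that, of k] \<xi>0[OF that]
    by (auto simp: stage_set_def)
  ultimately have "(u, \<xi>, r, b) \<in> feasible b0 q rmax M \<omega>"
    using \<xi> by (auto simp: feasible_def)
  then show ?thesis
    by blast
qed

text \<open>The objective is nonnegative and vanishes at r = 0, b = 0 without slack, which is
  feasible with a large \<open>u\<close> because the sampled bounds are nonnegative. Minimisers are
  therefore the feasible points of value 0.\<close>

lemma minimizer_iff_candidate:
  fixes \<omega> :: "nat \<Rightarrow> 'k::{finite,linorder} rvec_pair"
  assumes M: "1 \<le> M" and "0 \<le> rmax" "0 \<le> \<rho>"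
    and prices: "\<And>k. 0 \<le> \<pi>p $ k" "\<And>k. 0 \<le> \<pi>m $ k"
    and "\<forall>i\<in>{1..M}. \<forall>k. 0 \<le> snd (\<omega> i) $ k"
  shows "(\<exists>u \<xi>. minimizer b0 q rmax \<pi>p \<pi>m \<rho> M \<omega> (u, \<xi>, x))
    \<longleftrightarrow> x \<in> candidates rmax \<pi>p \<pi>m \<rho> (\<omega> ` {1..M})"
proof -
  have \<beta>: "0 \<le> snd (\<omega> i) $ k" if "i \<in> {1..M}" for i k
    using assms(6) that by blast
  let ?F = "feasible b0 q rmax M \<omega>" and ?J = "objective \<pi>p \<pi>m \<rho> M"
  have \<xi>0: "0 \<le> \<xi> i" if "(u, \<xi>, y) \<in> ?F" "i \<in> {1..M}" for u \<xi> y i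
    using that by (auto simp: feasible_def PiE_iff)
  have J: "0 \<le> ?J (u, \<xi>, y)" "?J (u, \<xi>, y) = 0 \<longleftrightarrow>
      cost \<pi>p \<pi>m (fst y) = 0 \<and> (\<rho> = 0 \<or> (\<forall>i\<in>{1..M}. \<xi> i = 0))" if "(u, \<xi>, y) \<in> ?F" for u \<xi> y
  proof -
    have "0 \<le> (\<Sum>i\<in>{1..M}. \<xi> i)"
      using \<xi>0[OF that] by (intro sum_nonneg)
    moreover have "(\<Sum>i\<in>{1..M}. \<xi> i) = 0 \<longleftrightarrow> (\<forall>i\<in>{1..M}. \<xi> i = 0)"
      using \<xi>0[OF that] by (intro sum_nonneg_eq_0_iff) auto
    ultimately show "0 \<le> ?J (u, \<xi>, y)" "?J (u, \<xi>, y) = 0 \<longleftrightarrow>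
      cost \<pi>p \<pi>m (fst y) = 0 \<and> (\<rho> = 0 \<or> (\<forall>i\<in>{1..M}. \<xi> i = 0))"
      using cost_nonneg[OF prices, of "fst y"] \<open>0 \<le> \<rho>\<close>
      by (auto simp: objective_def case_prod_beta add_nonneg_eq_0_iff)
  qed
  define zero :: "nat \<Rightarrow> real" where "zero = (\<lambda>i\<in>{1..M}. 0)"
  have zero: "zero \<in> {1..M} \<rightarrow>\<^sub>E {0..}"
    by (auto simp: zero_def)
  obtain u0 where u0: "(u0, zero, 0, 0) \<in> ?F"
    using feasible_exists_u[OF zero, of "0 :: 'k rvec" rmax "0 :: 'k rvec" \<omega> b0 q] \<beta> \<open>0 \<le> rmax\<close>
    by (auto simp: zero_def)
  have "?J (u0, zero, 0, 0) = 0"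
    using J(2)[OF u0] cost_eq_0_iff[OF prices, of 0] by (simp add: zero_def)
  then have min: "minimizer b0 q rmax \<pi>p \<pi>m \<rho> M \<omega> (u, \<xi>, y)
      \<longleftrightarrow> (u, \<xi>, y) \<in> ?F \<and> ?J (u, \<xi>, y) = 0" for u \<xi> y
    using u0 J(1) unfolding minimizer_def is_arg_min_def
    by (metis (no_types, opaque_lifting) antisym_conv2 linorder_not_less prod_cases3)
  show ?thesis
  proof
    assume "\<exists>u \<xi>. minimizer b0 q rmax \<pi>p \<pi>m \<rho> M \<omega> (u, \<xi>, x)"
    then obtain u \<xi> where F: "(u, \<xi>, x) \<in> ?F" and "?J (u, \<xi>, x) = 0"
      using min by blast
    then have c: "cost \<pi>p \<pi>m (fst x) = 0" and \<xi>: "\<rho> = 0 \<or> (\<forall>i\<in>{1..M}. \<xi> i = 0)"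
      using J(2)[OF F] by blast+
    obtain r b where x: "x = (r, b)"
      by (cases x)
    have st: "\<bar>r $ k\<bar> \<le> rmax \<and> 0 \<le> b $ k \<and> b $ k \<le> \<xi> i + snd (\<omega> i) $ k" if "i \<in> {1..M}" for i k
      using F that by (auto simp: feasible_def stage_set_def x)
    \<comment> \<open>The bounds on \<open>r\<close> and the sign of \<open>b\<close> come from the
      constraints of a sample, so at least one sample must be present.\<close>
    have "1 \<in> {1..M}"
      using M by simp
    note st1 = st[OF this]
    have "\<rho> = 0 \<or> (\<forall>s\<in>\<omega> ` {1..M}. b $ k \<le> snd s $ k)" for k
      using \<xi> st by fastforce
    then show "x \<in> candidates rmax \<pi>p \<pi>m \<rho> (\<omega> ` {1..M})"
      using st1 c unfolding candidates_def cost_eq_0_iff[OF prices] x by auto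
  next
    assume "x \<in> candidates rmax \<pi>p \<pi>m \<rho> (\<omega> ` {1..M})"
    moreover obtain r b where x: "x = (r, b)"
      by (cases x)
    ultimately have r: "\<bar>r $ k\<bar> \<le> rmax" "0 \<le> b $ k"
      and c: "cost \<pi>p \<pi>m r = 0"
      and b: "\<rho> = 0 \<or> (\<forall>i\<in>{1..M}. b $ k \<le> snd (\<omega> i) $ k)" for k
      by (auto simp: candidates_def cost_eq_0_iff[OF prices])
    \<comment> \<open>If \<rho> = 0, slack costs nothing and is taken large enough to cover every
      component of \<open>b\<close>; otherwise it has to be zero.\<close>
    define \<xi> where "\<xi> = (\<lambda>i\<in>{1..M}. if \<rho> = 0 then (\<Sum>k\<in>UNIV. \<bar>b $ k\<bar>) else 0)"
    have \<xi>: "\<xi> \<in> {1..M} \<rightarrow>\<^sub>E {0..}"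
      by (auto simp: \<xi>_def intro!: sum_nonneg)
    have "b $ k \<le> \<xi> i + snd (\<omega> i) $ k" if "i \<in> {1..M}" for k i
    proof (cases "\<rho> = 0")
      case True
      have "\<bar>b $ k\<bar> \<le> (\<Sum>k\<in>UNIV. \<bar>b $ k\<bar>)"
        by (intro member_le_sum[where f = "\<lambda>k. \<bar>b $ k\<bar>"]) auto
      then show ?thesis
        using True that \<beta>[OF that, of k] by (simp add: \<xi>_def)
    next
      case False
      then show ?thesis
        using b[of k] that by (auto simp: \<xi>_def)
    qed
    then obtain u where u: "(u, \<xi>, r, b) \<in> ?F"
      using feasible_exists_u[OF \<xi> r] by blast
    then have "?J (u, \<xi>, r, b) = 0"
      using J(2)[OF u] c by (auto simp: \<xi>_def)
    then show "\<exists>u \<xi>. minimizer b0 q rmax \<pi>p \<pi>m \<rho> M \<omega> (u, \<xi>, x)"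
      using min u x by blast
  qed
qed

text \<open>The tie-break sees only \<open>x\<close>, so \<open>u\<close> and the slacks can be
  quantified away before comparing.\<close>

lemma solution_iff_optimal_candidate:
  fixes \<omega> :: "nat \<Rightarrow> 'k::{finite,linorder} rvec_pair"
  assumes "1 \<le> M" "0 \<le> rmax" "0 \<le> \<rho>"
    and "\<And>k. 0 \<le> \<pi>p $ k" "\<And>k. 0 \<le> \<pi>m $ k"
    and "\<forall>i\<in>{1..M}. \<forall>k. 0 \<le> snd (\<omega> i) $ k"
  shows "(\<exists>u \<xi>. solution tb b0 q rmax \<pi>p \<pi>m \<rho> M \<omega> (u, \<xi>, x))
    \<longleftrightarrow> is_arg_min tb (\<lambda>x. x \<in> candidates rmax \<pi>p \<pi>m \<rho> (\<omega> ` {1..M})) x"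
proof -
  let ?min = "minimizer b0 q rmax \<pi>p \<pi>m \<rho> M \<omega>"
  have "(\<exists>u \<xi>. solution tb b0 q rmax \<pi>p \<pi>m \<rho> M \<omega> (u, \<xi>, x))
    \<longleftrightarrow> (\<exists>u \<xi>. ?min (u, \<xi>, x)) \<and> \<not> (\<exists>y. (\<exists>u \<xi>. ?min (u, \<xi>, y)) \<and> tb y < tb x)"
    by (auto simp: solution_def is_arg_min_def)
  then show ?thesis
    unfolding minimizer_iff_candidate[OF assms] is_arg_min_def .
qed

text \<open>The disjunctions test fixed data only; in each case the set is an intersection of
  half-spaces.\<close>

lemma convex_candidates: "convex (candidates rmax \<pi>p \<pi>m \<rho> A)"
proof (rule convexI)
  fix x y and u v :: real
  assume x: "x \<in> candidates rmax \<pi>p \<pi>m \<rho> A" and y: "y \<in> candidates rmax \<pi>p \<pi>m \<rho> A"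
    and uv: "0 \<le> u" "0 \<le> v" "u + v = 1"
  have ub: "u * a + v * b \<le> c" if "a \<le> c" "b \<le> c" for a b c :: real
    using convex_bound_le[OF that uv] .
  have lb: "c \<le> u * a + v * b" if "c \<le> a" "c \<le> b" for a b c :: real
    using ub[of "- a" "- c" "- b"] that by simp
  have nb: "- (u * a) - v * b \<le> c" if "- c \<le> a" "- c \<le> b" for a b c :: real
    using lb[OF that] by simp
  have cond: "\<bar>fst z $ k\<bar> \<le> rmax \<and> (\<pi>p $ k = 0 \<or> fst z $ k \<le> 0) \<and> (\<pi>m $ k = 0 \<or> 0 \<le> fst z $ k)
      \<and> 0 \<le> snd z $ k \<and> (\<rho> = 0 \<or> (\<forall>s\<in>A. snd z $ k \<le> snd s $ k))"
    if "z \<in> candidates rmax \<pi>p \<pi>m \<rho> A" for z k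
    using that by (simp add: candidates_def case_prod_beta)
  show "u *\<^sub>R x + v *\<^sub>R y \<in> candidates rmax \<pi>p \<pi>m \<rho> A"
    unfolding candidates_def case_prod_beta mem_Collect_eq
  proof
    fix k
    show "\<bar>fst (u *\<^sub>R x + v *\<^sub>R y) $ k\<bar> \<le> rmax \<and> (\<pi>p $ k = 0 \<or> fst (u *\<^sub>R x + v *\<^sub>R y) $ k \<le> 0)
      \<and> (\<pi>m $ k = 0 \<or> 0 \<le> fst (u *\<^sub>R x + v *\<^sub>R y) $ k) \<and> 0 \<le> snd (u *\<^sub>R x + v *\<^sub>R y) $ k
      \<and> (\<rho> = 0 \<or> (\<forall>s\<in>A. snd (u *\<^sub>R x + v *\<^sub>R y) $ k \<le> snd s $ k))"
      using cond[OF x, of k] cond[OF y, of k] by (auto simp: abs_le_iff intro!: ub lb nb)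
  qed
qed

lemma candidates_mono: "A \<subseteq> A' \<Longrightarrow> candidates rmax \<pi>p \<pi>m \<rho> A' \<subseteq> candidates rmax \<pi>p \<pi>m \<rho> A"
  unfolding candidates_def by blast

lemma candidates_extend:
  assumes "x \<in> candidates rmax \<pi>p \<pi>m \<rho> A" "\<And>s k. s \<in> A' - A \<Longrightarrow> snd x $ k \<le> snd s $ k"
  shows "x \<in> candidates rmax \<pi>p \<pi>m \<rho> A'"
  using assms unfolding candidates_def by fastforce

text \<open>The program restated for sets of samples. Uniqueness is demanded for nonempty finite
  sets, which is what programs with at least one sample provide; the empty set is left to
  \<open>ok\<close>.\<close>

locale energy_scenario =
  fixes b0 rmax \<rho> :: real and q \<pi>p \<pi>m :: "('k::{finite,linorder}) rvec" and L B :: "real set"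
    and P :: "'k rvec_pair measure" and tb :: "'k rvec_pair \<Rightarrow> real"
  assumes B: "B \<subseteq> {0..}"
    and P: "prob_space P" "sets P = sets (restrict_space borel (uncertainty_set L B))"
    and tie_break: "convex_on UNIV tb"
    and uniqueness: "\<And>A. \<lbrakk>finite A; A \<noteq> {}; A \<subseteq> uncertainty_set L B\<rbrakk> \<Longrightarrow>
      \<exists>!x. is_arg_min tb (\<lambda>x. x \<in> candidates rmax \<pi>p \<pi>m \<rho> A) x"
begin

abbreviation cand :: "'k rvec_pair set \<Rightarrow> 'k rvec_pair set" where
  "cand \<equiv> candidates rmax \<pi>p \<pi>m \<rho>"

definition optimal :: "'k rvec_pair set \<Rightarrow> 'k rvec_pair \<Rightarrow> bool" where
  "optimal A = is_arg_min tb (\<lambda>x. x \<in> cand A)"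

definition dec :: "'k rvec_pair set \<Rightarrow> 'k rvec_pair" where
  "dec A = (THE x. optimal A x)"

definition ok :: bool where
  "ok \<longleftrightarrow> (\<exists>!x. optimal {} x)"

lemma optimal_iff: "optimal A x \<longleftrightarrow> x \<in> cand A \<and> (\<forall>y\<in>cand A. tb x \<le> tb y)"
  by (auto simp: optimal_def is_arg_min_def not_less)

lemma cand_mono: "\<lbrakk>x \<in> cand A'; A \<subseteq> A'\<rbrakk> \<Longrightarrow> x \<in> cand A"
  using candidates_mono by blast

lemma space_P: "space P = uncertainty_set L B"
  using sets_eq_imp_space_eq[OF P(2)] by (simp add: space_restrict_space)

lemma dec_eqI: "\<lbrakk>\<exists>!x. optimal A x; optimal A x\<rbrakk> \<Longrightarrow> dec A = x"
  unfolding dec_def by (rule the1_equality)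

lemma optimal_dec: "\<exists>!x. optimal A x \<Longrightarrow> optimal A (dec A)"
  unfolding dec_def by (rule theI')

lemma ex1_optimal: "\<lbrakk>finite A; A \<noteq> {}; A \<subseteq> space P\<rbrakk> \<Longrightarrow> \<exists>!x. optimal A x"
  unfolding optimal_def space_P by (rule uniqueness)

text \<open>A sample that is not critical lies strictly above \<open>b\<close>, so the old optimum
  remains a candidate; it was best even among the more numerous candidates for
  \<open>A\<close>.\<close>

lemma dec_extend:
  assumes A: "finite A'" "A \<subseteq> A'" "A' \<subseteq> space P" "A' \<noteq> {}" "A \<noteq> {} \<or> ok"
    and nc: "\<And>s. s \<in> A' - A \<Longrightarrow> \<not> critical b0 q (dec A) s"
  shows "dec A' = dec A"
proof (rule dec_eqI)
  show "\<exists>!x. optimal A' x"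
    using A by (intro ex1_optimal)
  have "\<exists>!x. optimal A x"
  proof (cases "A = {}")
    case True
    then show ?thesis
      using A(5) by (simp add: ok_def)
  next
    case False
    then show ?thesis
      using A by (intro ex1_optimal) (auto intro: finite_subset)
  qed
  then have opt: "optimal A (dec A)"
    by (rule optimal_dec)
  have "snd (dec A) $ k \<le> snd s $ k" if "s \<in> A' - A" for s k
    using nc[OF that] unfolding critical_def by (meson linear)
  moreover have "dec A \<in> cand A"
    using opt by (simp add: optimal_iff)
  ultimately have "dec A \<in> cand A'"
    by (intro candidates_extend[where A = A and A' = A'])
  then show "optimal A' (dec A)"
    using opt cand_mono[OF _ A(2)] unfolding optimal_iff by blast
qed

text \<open>By convexity, dropping constraints that are not active at an optimum keeps it optimal.\<close>

lemma dec_prune: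
  assumes A: "finite A'" "A \<subseteq> A'" "A' \<subseteq> space P" "A' \<noteq> {}"
    and nc: "\<And>s. s \<in> A' - A \<Longrightarrow> \<not> critical b0 q (dec A') s"
  shows "(A \<noteq> {} \<or> ok) \<and> dec A = dec A'"
proof -
  define x where "x = dec A'"
  have unique: "\<exists>!x. optimal A' x"
    using A by (intro ex1_optimal)
  then have x: "optimal A' x"
    unfolding x_def by (rule optimal_dec)
  have strict: "snd x $ k < snd s $ k" if "s \<in> A' - A" for s k
    using nc[OF that] unfolding critical_def x_def by (meson not_le)
  \<comment> \<open>This single claim yields both the optimality of \<open>x\<close> for
    \<open>A\<close> and its uniqueness. Uniqueness has to be derived rather than quoted, since
    \<open>A\<close> may be empty; in that case it establishes \<open>ok\<close>.\<close>
  have eq: "y = x" if y: "y \<in> cand A" "tb y \<le> tb x" for y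
  proof -
    \<comment> \<open>A short move from \<open>x\<close> towards the competitor \<open>y\<close>
      preserves the strict inequalities of the dropped samples, so \<open>z t\<close> is a candidate
      for \<open>A'\<close> that is no worse than \<open>x\<close>, hence equal to
      \<open>x\<close>.\<close>
    define z where "z t = (1 - t) *\<^sub>R x + t *\<^sub>R y" for t
    have "\<forall>\<^sub>F t in at_right (0::real). \<forall>s\<in>A' - A. \<forall>k\<in>UNIV. snd (z t) $ k < snd s $ k"
    proof (intro eventually_ball_finite ballI)
      fix s k assume s: "s \<in> A' - A"
      have "((\<lambda>t. snd (z t) $ k) \<longlongrightarrow> (1 - 0) *\<^sub>R snd x $ k + 0 *\<^sub>R snd y $ k) (at_right 0)"
        unfolding z_def by (auto intro!: tendsto_eq_intros)
      then show "\<forall>\<^sub>F t in at_right 0. snd (z t) $ k < snd s $ k"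
        using strict[OF s, of k] by (intro order_tendstoD) auto
    qed (use A in auto)
    moreover have "\<forall>\<^sub>F t in at_right (0::real). t \<in> {0<..<1}"
      by (rule eventually_at_right_real) simp
    ultimately have "\<forall>\<^sub>F t in at_right (0::real).
        (\<forall>s\<in>A' - A. \<forall>k\<in>UNIV. snd (z t) $ k < snd s $ k) \<and> t \<in> {0<..<1}"
      by (rule eventually_conj)
    then obtain t where t': "(\<forall>s\<in>A' - A. \<forall>k\<in>UNIV. snd (z t) $ k < snd s $ k) \<and> t \<in> {0<..<1}"
      using eventually_happens'[OF trivial_limit_at_right_real] by blast
    then have t: "snd (z t) $ k < snd s $ k" if "s \<in> A' - A" for s k
      using that by auto
    have t01: "0 < t" "t < 1"
      using t' by auto
    have "z t \<in> cand A"
      unfolding z_def using x y(1) t01 cand_mono[OF _ A(2)]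
      by (intro convexD[OF convex_candidates]) (auto simp: optimal_iff)
    then have zA': "z t \<in> cand A'"
      using t by (intro candidates_extend[where A = A and A' = A']) (auto simp: less_imp_le)
    have "tb (z t) \<le> (1 - t) * tb x + t * tb y"
      unfolding z_def using t01 by (intro convex_onD[OF tie_break]) auto
    also have "\<dots> \<le> (1 - t) * tb x + t * tb x"
      using y(2) t01 by (intro add_left_mono mult_left_mono) auto
    finally have "tb (z t) \<le> tb x"
      by (simp add: algebra_simps)
    then have "optimal A' (z t)"
      using x zA' by (auto simp: optimal_iff intro: order_trans)
    then have "z t = x"
      using unique x by blast
    then have "t *\<^sub>R (y - x) = 0"
      by (simp add: z_def algebra_simps)
    then show "y = x"
      using t01 by simp
  qed
  have opt: "optimal A x"
    unfolding optimal_iff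
  proof (intro conjI ballI)
    show "x \<in> cand A"
      using x cand_mono[OF _ A(2)] by (simp add: optimal_iff)
    show "tb x \<le> tb y" if "y \<in> cand A" for y
      using eq[OF that] by (cases "tb y \<le> tb x") auto
  qed
  have ex1: "\<exists>!x. optimal A x"
  proof (rule ex1I[of _ x])
    show "y = x" if "optimal A y" for y
      using that opt eq by (auto simp: optimal_iff)
  qed (rule opt)
  have "dec A = x"
    by (rule dec_eqI[OF ex1 opt])
  then show ?thesis
    using ex1 by (auto simp: ok_def x_def)
qed

end

subsection \<open>Measurability of the solution\<close>

lemma borel_measurable_vec:
  assumes "\<And>k. (\<lambda>x. f x $ k) \<in> borel_measurable M"
  shows "(f :: 'a \<Rightarrow> (real, 'k::finite) vec) \<in> borel_measurable M"
  unfolding borel_measurable_euclidean_space[of f]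
proof
  fix i :: "(real, 'k) vec" assume "i \<in> Basis"
  then obtain k where "i = axis k 1"
    by (auto simp: Basis_vec_def)
  then show "(\<lambda>x. f x \<bullet> i) \<in> borel_measurable M"
    using assms[of k] by (simp add: inner_axis)
qed

lemma borel_measurable_component:
  assumes "f \<in> borel_measurable M"
  shows "(\<lambda>x. fst (f x) $ k) \<in> borel_measurable M" "(\<lambda>x. snd (f x) $ k) \<in> borel_measurable M"
  by (rule measurable_compose[OF assms borel_measurable_continuous_onI],
      intro continuous_intros)+

context energy_scenario begin

lemma borel_measurable_P: "f \<in> borel_measurable borel \<Longrightarrow> f \<in> borel_measurable P"
  by (subst measurable_cong_sets[OF P(2) refl]) (rule measurable_restrict_space1)

lemma continuous_on_tb: "continuous_on A tb"
  using convex_on_continuous[OF open_UNIV tie_break] continuous_on_subset by blast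

definition levels :: "'k rvec set" where
  "levels = {c. \<forall>k. c $ k \<in> B}"

text \<open>For \<rho> \<noteq> 0 a nonempty sample set matters only through the componentwise
  minimum \<open>c\<close> of its bounds, represented by one artificial sample. Its first component
  0 is a dummy that \<open>candidates\<close> ignores and may lie outside \<open>L\<close>.\<close>

definition argmin :: "'k rvec \<Rightarrow> 'k rvec_pair" where
  "argmin c = dec {(0, c)}"

lemma optimal_argmin:
  assumes c: "c \<in> levels"
  shows "\<exists>!x. optimal {(0, c)} x" and "optimal {(0, c)} (argmin c)"
proof -
  \<comment> \<open>A genuine sample lends its first component, so that the uniqueness assumption
    applies.\<close>
  obtain s where s: "s \<in> space P"
    using prob_space.not_empty[OF P(1)] by blast
  have "(fst s, c) \<in> space P"
    using s c by (auto simp: space_P uncertainty_set_def levels_def)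
  then have "\<exists>!x. optimal {(fst s, c)} x"
    by (intro ex1_optimal) auto
  moreover have "optimal {(fst s, c)} = optimal {(0, c)}"
    by (simp add: optimal_def candidates_def)
  ultimately show ex1: "\<exists>!x. optimal {(0, c)} x"
    by simp
  show "optimal {(0, c)} (argmin c)"
    unfolding argmin_def by (rule optimal_dec[OF ex1])
qed

text \<open>The graph of \<open>argmin\<close> is closed: a candidate \<open>(r, b)\<close> for one bound \<open>c\<close> becomes a
  candidate for another one when \<open>b\<close> is truncated at it.\<close>

lemma continuous_on_argmin_bounded:
  assumes \<rho>: "\<rho> \<noteq> 0"
  shows "continuous_on (levels \<inter> {c. \<forall>k. c $ k \<le> R}) argmin"
proof -
  define S where "S = levels \<inter> {c. \<forall>k. c $ k \<le> R}"
  \<comment> \<open>All optima for bounds below \<open>R\<close> lie in this compact box; for maps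
    into a compact space a closed graph means continuity.\<close>
  define T :: "'k rvec_pair set" where
    "T = cbox (\<chi> k. - rmax) (\<chi> k. rmax) \<times> cbox (\<chi> k. 0) (\<chi> k. R)"
  define C where "C = {(c, x). x \<in> cand {(0, c)}}"
  \<comment> \<open>The competitors range over a set independent of \<open>c\<close>, and each
    enters after truncation at \<open>c\<close>. Optimality thus becomes an intersection of
    conditions that are closed in \<open>(c, x)\<close> jointly.\<close>
  define Q where "Q = (\<Inter>y\<in>cand {}. {(c, x). tb x \<le> tb (fst y, \<chi> k. min (snd y $ k) (c $ k))})"
  have C_eq: "C = {z. \<forall>k. \<bar>fst (snd z) $ k\<bar> \<le> rmax \<and> (\<pi>p $ k = 0 \<or> fst (snd z) $ k \<le> 0)
      \<and> (\<pi>m $ k = 0 \<or> 0 \<le> fst (snd z) $ k) \<and> 0 \<le> snd (snd z) $ k \<and> snd (snd z) $ k \<le> fst z $ k}"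
    using \<rho> by (auto simp: C_def candidates_def)
  have "closed C"
    unfolding C_eq
    by (intro closed_Collect_all closed_Collect_conj closed_Collect_disj closed_Collect_const
        closed_Collect_le continuous_intros)
  moreover have "closed Q"
    unfolding Q_def case_prod_beta
    by (intro closed_INT ballI closed_Collect_le continuous_on_compose2[OF continuous_on_tb[of UNIV]]
        continuous_intros continuous_on_vec_lambda) auto
  ultimately have "closed (C \<inter> Q)"
    by (rule closed_Int)
  have opt: "(c, x) \<in> C \<inter> Q \<longleftrightarrow> optimal {(0, c)} x" if c: "c \<in> levels" for c x
  proof
    assume x: "(c, x) \<in> C \<inter> Q"
    have "tb x \<le> tb y" if y: "y \<in> cand {(0, c)}" for y
    proof -
      have "snd y $ k \<le> c $ k" for k
        using y \<rho> by (auto simp: candidates_def)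
      then have "(fst y, \<chi> k. min (snd y $ k) (c $ k)) = y"
        by (simp add: prod_eq_iff vec_eq_iff min_absorb1)
      moreover have "y \<in> cand {}"
        using y cand_mono by blast
      ultimately show ?thesis
        using x unfolding Q_def by force
    qed
    then show "optimal {(0, c)} x"
      using x by (auto simp: optimal_iff C_def)
  next
    assume x: "optimal {(0, c)} x"
    have "tb x \<le> tb (fst y, \<chi> k. min (snd y $ k) (c $ k))" if "y \<in> cand {}" for y
    proof -
      have "0 \<le> c $ k" for k
        using c B by (auto simp: levels_def)
      then have "(fst y, \<chi> k. min (snd y $ k) (c $ k)) \<in> cand {(0, c)}"
        using that by (auto simp: candidates_def)
      then show ?thesis
        using x by (simp add: optimal_iff)
    qed
    then show "(c, x) \<in> C \<inter> Q"
      using x by (auto simp: optimal_iff C_def Q_def)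
  qed
  have fT: "argmin \<in> S \<rightarrow> T"
  proof
    fix c assume c: "c \<in> S"
    have x: "argmin c \<in> cand {(0, c)}"
      using optimal_argmin(2)[of c] c by (simp add: optimal_iff S_def)
    have "snd (argmin c) $ k \<le> R" for k
    proof -
      have "snd (argmin c) $ k \<le> c $ k"
        using x \<rho> by (auto simp: candidates_def)
      also have "\<dots> \<le> R"
        using c by (simp add: S_def)
      finally show ?thesis .
    qed
    then show "argmin c \<in> T"
      using x by (auto simp: T_def candidates_def mem_Times_iff mem_box_cart abs_le_iff minus_le_iff)
  qed
  have "(\<lambda>c. (c, argmin c)) ` S = S \<times> T \<inter> (C \<inter> Q)"
  proof (intro equalityI subsetI)
    fix z assume "z \<in> (\<lambda>c. (c, argmin c)) ` S"
    then obtain c where c: "c \<in> S" and z: "z = (c, argmin c)"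
      by blast
    have "(c, argmin c) \<in> C \<inter> Q"
      using c opt[of c] optimal_argmin(2)[of c] by (simp add: S_def)
    then show "z \<in> S \<times> T \<inter> (C \<inter> Q)"
      using z c fT by blast
  next
    fix z assume z: "z \<in> S \<times> T \<inter> (C \<inter> Q)"
    obtain c x where cx: "z = (c, x)"
      by (cases z)
    have c: "c \<in> levels" "c \<in> S"
      using z by (auto simp: S_def cx)
    then have "optimal {(0, c)} x"
      using opt z cx by blast
    then have "x = argmin c"
      using optimal_argmin[OF c(1)] by blast
    then show "z \<in> (\<lambda>c. (c, argmin c)) ` S"
      using c(2) cx by blast
  qed
  then have "closedin (top_of_set (S \<times> T)) ((\<lambda>c. (c, argmin c)) ` S)"
    using \<open>closed (C \<inter> Q)\<close> by (auto intro: closedin_closed_Int)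
  moreover have "compact T"
    unfolding T_def by (intro compact_Times compact_cbox)
  ultimately show ?thesis
    using continuous_closed_graph_eq[OF \<open>compact T\<close> fT] by (simp add: S_def)
qed

text \<open>Continuity is local, and every \<open>c\<close> has an open neighbourhood on which the
  components stay below a common \<open>R\<close>.\<close>

lemma continuous_on_argmin:
  assumes "\<rho> \<noteq> 0"
  shows "continuous_on levels argmin"
  unfolding continuous_on_eq_continuous_within
proof
  fix c assume c: "c \<in> levels"
  define R where "R = Max (range (($) c)) + 1"
  define U :: "'k rvec set" where "U = {c. \<forall>k. c $ k < R}"
  have "c $ k \<le> Max (range (($) c))" for k
    by (rule Max_ge) auto
  then have "c $ k < R" for k
    by (simp add: R_def add_strict_increasing2 le_less_trans[OF _ less_add_one])
  then have cU: "c \<in> U"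
    by (simp add: U_def)
  have "open U"
  proof -
    have "U = (\<Inter>k\<in>UNIV. {c. c $ k < R})"
      by (auto simp: U_def)
    also have "open \<dots>"
      by (intro open_INT ballI open_Collect_less continuous_intros) auto
    finally show ?thesis .
  qed
  have "continuous_on (levels \<inter> U) argmin"
    by (rule continuous_on_subset[OF continuous_on_argmin_bounded[OF assms, of R]])
      (auto simp: U_def less_imp_le)
  then have "continuous (at c within levels \<inter> U) argmin"
    using c cU by (simp add: continuous_on_eq_continuous_within)
  moreover have "at c within levels \<inter> U = at c within levels"
    by (rule at_within_nhd[OF cU \<open>open U\<close>]) auto
  ultimately show "continuous (at c within levels) argmin"
    by simp
qed

text \<open>The decision is the continuous function \<open>argmin\<close> applied to a measurable
  componentwise minimum. If there are no samples, or \<rho> = 0, the candidates and hence the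
  decision are constant.\<close>

lemma dec_measurable:
  fixes I :: "nat set"
  assumes I: "finite I"
  shows "(\<lambda>\<omega>. dec (\<omega> ` I)) \<in> Pi\<^sub>M I (\<lambda>_. P) \<rightarrow>\<^sub>M borel"
proof (cases "I = {} \<or> \<rho> = 0")
  case True
  then have "cand (\<omega> ` I) = cand {}" for \<omega> :: "nat \<Rightarrow> 'k rvec_pair"
    by (auto simp: candidates_def)
  then have "dec (\<omega> ` I) = dec {}" for \<omega> :: "nat \<Rightarrow> 'k rvec_pair"
    by (simp add: dec_def optimal_def)
  then show ?thesis
    by simp
next
  case False
  define c :: "(nat \<Rightarrow> 'k rvec_pair) \<Rightarrow> 'k rvec" where
    "c \<omega> = (\<chi> k. Min ((\<lambda>i. snd (\<omega> i) $ k) ` I))" for \<omega>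
  have "c \<in> borel_measurable (Pi\<^sub>M I (\<lambda>_. P))"
  proof (rule borel_measurable_vec)
    fix k
    have "(\<lambda>\<omega>. snd (\<omega> i) $ k) \<in> borel_measurable (Pi\<^sub>M I (\<lambda>_. P))" if "i \<in> I" for i
      by (rule measurable_compose[OF measurable_component_singleton[OF that]
          borel_measurable_P[OF borel_measurable_component(2)]]) simp
    then show "(\<lambda>\<omega>. c \<omega> $ k) \<in> borel_measurable (Pi\<^sub>M I (\<lambda>_. P))"
      using I by (simp add: c_def borel_measurable_Min)
  qed
  moreover have "c \<omega> \<in> levels" if "\<omega> \<in> space (Pi\<^sub>M I (\<lambda>_. P))" for \<omega>
  proof -
    \<comment> \<open>The minimum is attained at a sample, so \<open>c\<close> stays in
      \<open>levels\<close> for an arbitrary set \<open>B\<close>.\<close>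
    have "Min ((\<lambda>i. snd (\<omega> i) $ k) ` I) \<in> B" for k
    proof -
      have "Min ((\<lambda>i. snd (\<omega> i) $ k) ` I) \<in> (\<lambda>i. snd (\<omega> i) $ k) ` I"
        using I False by (intro Min_in) auto
      then show ?thesis
        using that by (auto simp: space_PiM space_P uncertainty_set_def PiE_iff)
    qed
    then show ?thesis
      by (simp add: levels_def c_def)
  qed
  ultimately have "c \<in> Pi\<^sub>M I (\<lambda>_. P) \<rightarrow>\<^sub>M restrict_space borel levels"
    by (intro measurable_restrict_space2) auto
  moreover have "argmin \<in> restrict_space borel levels \<rightarrow>\<^sub>M borel"
    using False by (intro borel_measurable_continuous_on_restrict continuous_on_argmin) simp
  ultimately have "(\<lambda>\<omega>. argmin (c \<omega>)) \<in> Pi\<^sub>M I (\<lambda>_. P) \<rightarrow>\<^sub>M borel"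
    by (rule measurable_compose)
  moreover have "argmin (c \<omega>) = dec (\<omega> ` I)" for \<omega>
  proof -
    have "cand {(0, c \<omega>)} = cand (\<omega> ` I)"
      using I False by (simp add: candidates_def c_def)
    then show ?thesis
      by (simp add: argmin_def dec_def optimal_def)
  qed
  ultimately show ?thesis
    by simp
qed

lemma prev_state_measurable:
  fixes f :: "'a \<Rightarrow> 'k rvec_pair"
  assumes "f \<in> borel_measurable M"
  shows "(\<lambda>x. prev_state b0 (snd (f x)) k) \<in> borel_measurable M"
  using borel_measurable_component(2)[OF assms] by (simp add: prev_state_def)

lemma critical_measurable: "Measurable.pred (borel \<Otimes>\<^sub>M P) (\<lambda>(x, s). critical b0 q x s)"
proof -
  have s: "snd \<in> borel_measurable (borel \<Otimes>\<^sub>M P)"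
    by (rule measurable_compose[OF measurable_snd borel_measurable_P[OF measurable_ident_sets[OF refl]]])
  note [measurable] = borel_measurable_component[OF measurable_fst[of borel P]]
    borel_measurable_component[OF s] prev_state_measurable[OF measurable_fst[of borel P]]
  show ?thesis
    unfolding critical_def case_prod_beta by measurable
qed

sublocale scenario_rule P borel dec "critical b0 q" ok
proof (intro scenario_rule.intro scenario_rule_axioms.intro)
  show "prob_space P"
    by (rule P)
qed (fact critical_measurable dec_measurable dec_extend dec_prune)+

end

text \<open>A candidate satisfies the constraints free of uncertainty, so it is violated only by
  strict inequalities in the sample. Criticality also counts equality; the difference is the null
  set of the non-accumulation assumption.\<close>

lemma (in energy_scenario) violation_eq:
  assumes x: "(r, b) \<in> cand A"
    and na: "measure P {s \<in> space P. \<exists>k. b $ k = prev_state b0 b k + q $ k + r $ k - fst s $ k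
        \<or> b $ k = snd s $ k} = 0"
  shows "violation P b0 q rmax r b = 1 - safe (r, b)"
proof -
  note [measurable] = borel_measurable_component[OF borel_measurable_P[OF measurable_ident_sets[OF refl]]]
  define V where "V = {s \<in> space P. \<exists>k. b $ k < prev_state b0 b k + q $ k + r $ k - fst s $ k
    \<or> snd s $ k < b $ k}"
  define Z where "Z = {s \<in> space P. \<exists>k. b $ k = prev_state b0 b k + q $ k + r $ k - fst s $ k
    \<or> b $ k = snd s $ k}"
  have sets: "V \<in> sets P" "Z \<in> sets P"
    unfolding V_def Z_def by measurable
  have viol: "violation P b0 q rmax r b = measure P V"
    using x by (auto simp: violation_def V_def stage_set_def candidates_def not_le
        intro!: arg_cong[where f = "measure P"])
  have crit: "{s \<in> space P. critical b0 q (r, b) s} = V \<union> Z"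
    unfolding critical_def V_def Z_def fst_conv snd_conv order_le_less
    by (rule set_eqI, simp only: Un_iff mem_Collect_eq) metis
  have "measure P (V \<union> Z) \<le> measure P V + measure P Z"
    using sets by (intro measure_Un_le)
  moreover have "measure P V \<le> measure P (V \<union> Z)"
    using sets by (intro finite_measure_mono) auto
  ultimately have "measure P (V \<union> Z) = measure P V"
    using na by (simp add: Z_def)
  moreover have "measure P {s \<in> space P. \<not> critical b0 q (r, b) s}
      = 1 - measure P {s \<in> space P. critical b0 q (r, b) s}"
    using sets crit by (intro prob_neg) simp
  ultimately show ?thesis
    by (simp add: viol safe_def crit)
qed

theorem proposition1:
  fixes b0 rmax \<rho> \<delta> :: real
    and q \<pi>p \<pi>m :: "('k::{finite,linorder}) rvec"
    and L B :: "real set"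
    and P :: "'k rvec_pair measure"
    and N :: nat
    and tb :: "'k rvec_pair \<Rightarrow> real"
    and us rs bs :: "(nat \<Rightarrow> 'k rvec_pair) \<Rightarrow> 'k rvec"
    and \<xi>s :: "(nat \<Rightarrow> 'k rvec_pair) \<Rightarrow> nat \<Rightarrow> real"
  assumes N: "1 \<le> N"
    and rmax: "0 \<le> rmax" and \<rho>: "0 \<le> \<rho>"
    and prices_nonneg: "\<And>k. 0 \<le> \<pi>p $ k" "\<And>k. 0 \<le> \<pi>m $ k"
    and prices: "\<And>k. \<pi>m $ k \<le> \<pi>p $ k"
    and L: "L \<subseteq> {0..}" and B: "B \<subseteq> {0..}"
    and P: "prob_space P" "sets P = sets (restrict_space borel (uncertainty_set L B))"
    and tie_break: "convex_on UNIV tb"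
    and uniqueness: "\<And>M \<omega>. 1 \<le> M \<Longrightarrow> \<omega> \<in> {1..M} \<rightarrow>\<^sub>E uncertainty_set L B \<Longrightarrow>
      \<exists>!x. \<exists>u \<xi>. solution tb b0 q rmax \<pi>p \<pi>m \<rho> M \<omega> (u, \<xi>, x)"
    and non_accumulation: "\<And>r b :: 'k rvec.
      measure P {s \<in> space P. \<exists>k. b $ k = prev_state b0 b k + q $ k + r $ k - fst s $ k
                                   \<or> b $ k = snd s $ k} = 0"
    and \<delta>: "0 < \<delta>" "\<delta> < 1"
    and sol: "\<And>\<omega>. \<omega> \<in> {1..N} \<rightarrow>\<^sub>E uncertainty_set L B \<Longrightarrow>
      solution tb b0 q rmax \<pi>p \<pi>m \<rho> N \<omega> (us \<omega>, \<xi>s \<omega>, rs \<omega>, bs \<omega>)"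
  shows "(\<forall>m<N. card (eps_roots N \<delta> m) = 2) \<and>
    (\<exists>!t. t \<in> eps_roots N \<delta> N) \<and>
    measure (Pi\<^sub>M {1..N} (\<lambda>_. P))
      {\<omega> \<in> space (Pi\<^sub>M {1..N} (\<lambda>_. P)).
         eps_lower N \<delta> (num_critical b0 q N \<omega> (rs \<omega>) (bs \<omega>)) \<le> violation P b0 q rmax (rs \<omega>) (bs \<omega>) \<and>
         violation P b0 q rmax (rs \<omega>) (bs \<omega>) \<le> eps_upper N \<delta> (num_critical b0 q N \<omega> (rs \<omega>) (bs \<omega>))}
      \<ge> 1 - \<delta>"
proof -
  have \<beta>: "\<forall>i\<in>{1..M}. \<forall>k. 0 \<le> snd (\<omega> i) $ k"
    if "\<omega> \<in> {1..M} \<rightarrow>\<^sub>E uncertainty_set L B" for M and \<omega> :: "nat \<Rightarrow> 'k rvec_pair"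
  proof (intro ballI allI)
    fix i k assume "i \<in> {1..M}"
    then have "\<omega> i \<in> uncertainty_set L B"
      using that by (rule PiE_mem[rotated])
    then have "snd (\<omega> i) $ k \<in> B"
      by (auto simp: uncertainty_set_def)
    then show "0 \<le> snd (\<omega> i) $ k"
      using B by auto
  qed
  note sol_iff = solution_iff_optimal_candidate[OF _ rmax \<rho> prices_nonneg \<beta>]
  interpret E: energy_scenario b0 rmax \<rho> q \<pi>p \<pi>m L B P tb
  proof (rule energy_scenario.intro)
    fix A :: "'k rvec_pair set"
    assume A: "finite A" "A \<noteq> {}" "A \<subseteq> uncertainty_set L B"
    \<comment> \<open>Enumerating \<open>A\<close> gives a sequence of \<open>card A\<close> samples
      with image \<open>A\<close>, which transfers uniqueness from sequences to sets.\<close>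
    then obtain f where f: "bij_betw f {1..card A} A"
      using ex_bij_betw_nat_finite_1 by blast
    define \<omega> where "\<omega> = restrict f {1..card A}"
    have im: "\<omega> ` {1..card A} = A"
      using f by (auto simp: \<omega>_def bij_betw_def)
    have M: "1 \<le> card A"
      using A by (simp add: Suc_le_eq card_gt_0_iff)
    have \<omega>: "\<omega> \<in> {1..card A} \<rightarrow>\<^sub>E uncertainty_set L B"
      using im A(3) by (auto simp: \<omega>_def)
    show "\<exists>!x. is_arg_min tb (\<lambda>x. x \<in> candidates rmax \<pi>p \<pi>m \<rho> A) x"
      using uniqueness[OF M \<omega>] unfolding sol_iff[OF M \<omega>] im .
  qed (fact B P tie_break)+
  let ?PN = "Pi\<^sub>M {1..N} (\<lambda>_. P)"
  interpret PN: prob_space ?PN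
    by (rule prob_space_PiM) (rule P(1))
  \<comment> \<open>The failure of either bound, expressed in t, which stands for one minus the
    violation probability.\<close>
  define R where "R m = {t. 1 - t < eps_lower N \<delta> m \<or> eps_upper N \<delta> m < 1 - t}" for m
  define Bad where "Bad = {\<omega> \<in> space ?PN.
    E.safe (E.dec (\<omega> ` {1..N})) \<in> R (card (E.critical_set {1..N} \<omega>))}"
  have R: "R m \<in> sets borel" for m
    unfolding R_def by measurable
  let ?Ms = "{0..<N} \<union> {N+1..4*N}"
  let ?c = "\<lambda>M. if M < N then \<delta> / (2 * real N) else \<delta> / (6 * real N)"
  have c: "0 \<le> ?c M" for M
    using \<delta> by simp
  have bound: "real (N choose m) * t ^ (N - m) \<le> (\<Sum>M\<in>?Ms. ?c M * (real (M choose m) * t ^ (M - m)))"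
    if "m \<le> N" "0 \<le> t" "t \<le> 1" "t \<in> R m" for m t
    using that by (intro eps_bound_violated N \<delta>) (auto simp: R_def)
  have fin: "finite ?Ms"
    by simp
  note risk = E.scenario_risk[where R = R and c = ?c, OF N fin c R, folded Bad_def]
  have Bad_sets: "Bad \<in> sets ?PN"
    by (rule risk(1)) (rule bound)
  have "emeasure ?PN Bad \<le> ennreal (\<Sum>M\<in>?Ms. ?c M)"
    by (rule risk(2)) (rule bound)
  then have "measure ?PN Bad \<le> \<delta>"
    using \<delta> unfolding eps_weights_sum[OF N] PN.emeasure_eq_measure by simp
  \<comment> \<open>By uniqueness every selection \<open>(rs, bs)\<close> of solutions coincides
    with \<open>E.dec\<close>. The event in the claim is therefore exactly the complement of
    \<open>Bad\<close>, which also makes it measurable.\<close>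
  moreover have "{\<omega> \<in> space ?PN.
         eps_lower N \<delta> (num_critical b0 q N \<omega> (rs \<omega>) (bs \<omega>)) \<le> violation P b0 q rmax (rs \<omega>) (bs \<omega>) \<and>
         violation P b0 q rmax (rs \<omega>) (bs \<omega>) \<le> eps_upper N \<delta> (num_critical b0 q N \<omega> (rs \<omega>) (bs \<omega>))}
      = space ?PN - Bad"
  proof -
    have "violation P b0 q rmax (rs \<omega>) (bs \<omega>) = 1 - E.safe (E.dec (\<omega> ` {1..N}))
      \<and> num_critical b0 q N \<omega> (rs \<omega>) (bs \<omega>) = card (E.critical_set {1..N} \<omega>)"
      if "\<omega> \<in> space ?PN" for \<omega>
    proof -
      have \<omega>: "\<omega> \<in> {1..N} \<rightarrow>\<^sub>E uncertainty_set L B"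
        using that by (simp add: space_PiM E.space_P)
      have opt: "E.optimal (\<omega> ` {1..N}) (rs \<omega>, bs \<omega>)"
        unfolding E.optimal_def by (rule iffD1[OF sol_iff[OF N \<omega>]], intro exI, rule sol[OF \<omega>])
      have "\<omega> ` {1..N} \<subseteq> space P"
        using \<omega> by (auto simp: E.space_P)
      then have dec: "E.dec (\<omega> ` {1..N}) = (rs \<omega>, bs \<omega>)"
        using N by (intro E.dec_eqI[OF E.ex1_optimal opt]) auto
      have "violation P b0 q rmax (rs \<omega>) (bs \<omega>) = 1 - E.safe (rs \<omega>, bs \<omega>)"
        using opt unfolding E.optimal_iff
        by (intro E.violation_eq[where A = "\<omega> ` {1..N}"] non_accumulation) (rule conjunct1)
      moreover have "num_critical b0 q N \<omega> (rs \<omega>) (bs \<omega>) = card (E.critical_set {1..N} \<omega>)"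
        unfolding num_critical_def E.critical_set_def dec critical_def by simp
      ultimately show ?thesis
        unfolding dec by blast
    qed
    then show ?thesis
      unfolding Bad_def R_def by (auto simp: not_less)
  qed
  ultimately have "1 - \<delta> \<le> measure ?PN {\<omega> \<in> space ?PN.
         eps_lower N \<delta> (num_critical b0 q N \<omega> (rs \<omega>) (bs \<omega>)) \<le> violation P b0 q rmax (rs \<omega>) (bs \<omega>) \<and>
         violation P b0 q rmax (rs \<omega>) (bs \<omega>) \<le> eps_upper N \<delta> (num_critical b0 q N \<omega> (rs \<omega>) (bs \<omega>))}"
    using PN.prob_compl[OF Bad_sets] by simp
  then show ?thesis
    using card_eps_roots[OF _ \<delta>] eps_roots_top[OF N \<delta>(1)] by blast
qed

end
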